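(* Let $X$ be a toric variety with acting torus $\mathbb{T}$ and fan $\Sigma$. Consider a non-trivial action $\mathbb{G}_a\times X\to X$ normalized by $\mathbb{T}$, represented by a Demazure root $e$ of $\Sigma$, so that $\mathbb{T}$ acts on $\mathbb{G}_a$ by conjugation with the character $e$ and the semidirect product of $\mathbb{T}$ and $\mathbb{G}_a$ acts on $X$. Let $T=\mathrm{Ker}(e)\subseteq\mathbb{T}$ and $\mathbb{G}:=T\times\mathbb{G}_a$. Then the variety $X$ is an equivariant embedding of $\mathbb{G}$.
   Context: $\mathbb{K}$ is an algebraically closed field of characteristic zero, $\mathbb{G}_a=(\mathbb{K},+)$. An equivariant embedding of an algebraic group $G$ is a pair $(X,x)$, where $X$ is a (normal) algebraic variety with a regular action $G\times X\to X$ and $x\in X$ is a point with trivial stabilizer such that the orbit $Gx$ is open and dense in $X$. Toric notation: $M$ is the character lattice of $\mathbb{T}$, $N$ the dual lattice of one-parameter subgroups, $\langle\cdot,\cdot\rangle$ the pairing. A toric variety $X$ with acting torus $\mathbb{T}$ (a normal variety with an effective action of $\mathbb{T}$ having an open orbit) corresponds to a fan $\Sigma$ in $N_{\mathbb{Q}}=N\otimes_{\mathbb{Z}}\mathbb{Q}$, and $U_\sigma=\mathrm{Spec}\,\mathbb{K}[\sigma^\vee\cap M]$ is the affine chart of $\sigma\in\Sigma$. $\Sigma(1)$ is the set of rays of $\Sigma$ and $n_\rho$ is the primitive lattice vector on a ray $\rho$. A Demazure root of $\Sigma$ is a vector $e\in M$ for which there is a ray $\rho\in\Sigma(1)$ (the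 distinguished ray of $e$, denoted $\rho_e$; put $n_e=n_{\rho_e}$) such that: (1) $\langle n_\rho,e\rangle=-1$ and $\langle n_{\rho'},e\rangle\geq 0$ for all $\rho'\in\Sigma(1)$, $\rho'\neq\rho$; (2) if $\sigma\in\Sigma$ and $\langle v,e\rangle=0$ for all $v\in\sigma$, then the cone generated by $\sigma$ and $\rho$ is in $\Sigma$ as well. Demazure roots of $\Sigma$ correspond bijectively to non-trivial $\mathbb{G}_a$-actions on $X$ normalized by $\mathbb{T}$ (up to rescaling of $\mathbb{G}_a$): for each $\sigma\in\Sigma$ containing $\rho_e$ the chart $U_\sigma$ is invariant and $s\in\mathbb{G}_a$ acts on $\mathbb{K}[U_\sigma]$ by $\exp(s\partial_e)$ with $\partial_e(\chi^m)=\langle n_e,m\rangle\chi^{m+e}$, while the points outside the union of these charts are fixed. *)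

theory Defs
  imports
    "HOL-Analysis.Analysis"
    "HOL-Algebra.Group_Action"
    "HOL-Computational_Algebra.Polynomial"
    "HOL-Library.Poly_Mapping"
begin

text \<open>
  Varieties are treated classically, through their closed points: a topological space together
  with, for each open set, the functions into the ground field that are regular there.
  Elements of \<open>reg X U\<close> are total functions of which only the restriction to \<open>U\<close> matters, and
  \<open>reg X U\<close> is meaningful for open \<open>U\<close> only.
\<close>

record ('p, 'k) fspace =
  topol :: "'p topology"
  reg :: "'p set \<Rightarrow> ('p \<Rightarrow> 'k) set"

definition points :: "('p, 'k) fspace \<Rightarrow> 'p set" where
  "points X = topspace (topol X)"

definition space_with_functions :: "('p, 'k::field) fspace \<Rightarrow> bool" where
  "space_with_functions X \<longleftrightarrow>
     (\<forall>U. openin (topol X) U \<longrightarrow>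
        (\<forall>c. (\<lambda>_. c) \<in> reg X U) \<and>
        (\<forall>f\<in>reg X U. \<forall>g\<in>reg X U. (\<lambda>x. f x + g x) \<in> reg X U \<and> (\<lambda>x. f x * g x) \<in> reg X U) \<and>
        (\<forall>f\<in>reg X U. \<forall>g. (\<forall>x\<in>U. g x = f x) \<longrightarrow> g \<in> reg X U) \<and>
        (\<forall>f\<in>reg X U. openin (topol X) {x\<in>U. f x \<noteq> 0} \<and>
                      (\<lambda>x. inverse (f x)) \<in> reg X {x\<in>U. f x \<noteq> 0})) \<and>
     (\<forall>\<U> f. (\<forall>U\<in>\<U>. openin (topol X) U) \<longrightarrow>
        (f \<in> reg X (\<Union>\<U>) \<longleftrightarrow> (\<forall>U\<in>\<U>. f \<in> reg X U)))"

definition morphism :: "('p, 'k) fspace \<Rightarrow> ('q, 'k) fspace \<Rightarrow> ('p \<Rightarrow> 'q) \<Rightarrow> bool" where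
  "morphism X Y \<phi> \<longleftrightarrow>
     continuous_map (topol X) (topol Y) \<phi> \<and>
     (\<forall>V f. openin (topol Y) V \<longrightarrow> f \<in> reg Y V \<longrightarrow>
        (\<lambda>x. f (\<phi> x)) \<in> reg X {x\<in>points X. \<phi> x \<in> V})"

text \<open>Regular functions on a subset are those that locally extend to regular functions on \<open>X\<close>.\<close>

definition induced :: "('p, 'k) fspace \<Rightarrow> 'p set \<Rightarrow> ('p, 'k) fspace" where
  "induced X Z =
     \<lparr>topol = subtopology (topol X) Z,
      reg = (\<lambda>W. {f. \<forall>x\<in>W. \<exists>U g. openin (topol X) U \<and> x \<in> U \<and> g \<in> reg X U \<and>
                           (\<forall>y\<in>W \<inter> U. f y = g y)})\<rparr>"

text \<open>
  The structure defined on a set by an algebra \<open>A\<close> of functions: the principal open sets form a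
  base, and regular functions are locally quotients of elements of \<open>A\<close>.
\<close>

definition alg_space :: "'p set \<Rightarrow> ('p \<Rightarrow> 'k::field) set \<Rightarrow> ('p, 'k) fspace" where
  "alg_space V A =
     \<lparr>topol = topology_generated_by ((\<lambda>f. {x\<in>V. f x \<noteq> 0}) ` A),
      reg = (\<lambda>W. {h. \<forall>x\<in>W. \<exists>a\<in>A. \<exists>b\<in>A. b x \<noteq> 0 \<and>
                           (\<forall>y\<in>W. b y \<noteq> 0 \<longrightarrow> h y = a y / b y)})\<rparr>"

text \<open>
  The product in the category of spaces with functions. Its topology is finer than the
  product topology: it has the sets of non-vanishing of the functions
  \<open>\<Sum>i. f\<^sub>i(x) g\<^sub>i(y)\<close> as a base.
\<close>

definition tensor_funs ::
  "('p, 'k::field) fspace \<Rightarrow> ('q, 'k) fspace \<Rightarrow> 'p set \<Rightarrow> 'q set \<Rightarrow> ('p \<times> 'q \<Rightarrow> 'k) set" where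
  "tensor_funs X Y U V =
     {(\<lambda>(x, y). \<Sum>i<r. f i x * g i y) | (r::nat) f g.
        (\<forall>i<r. f i \<in> reg X U) \<and> (\<forall>i<r. g i \<in> reg Y V)}"

definition prod_space ::
  "('p, 'k::field) fspace \<Rightarrow> ('q, 'k) fspace \<Rightarrow> ('p \<times> 'q, 'k) fspace" where
  "prod_space X Y =
     \<lparr>topol = topology_generated_by
        {{p \<in> U \<times> V. h p \<noteq> 0} | U V h.
           openin (topol X) U \<and> openin (topol Y) V \<and> h \<in> tensor_funs X Y U V},
      reg = (\<lambda>W. {h. \<forall>p\<in>W. \<exists>U V. openin (topol X) U \<and> openin (topol Y) V \<and> p \<in> U \<times> V \<and>
               (\<exists>a\<in>tensor_funs X Y U V. \<exists>b\<in>tensor_funs X Y U V. b p \<noteq> 0 \<and>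
                  (\<forall>q\<in>W \<inter> (U \<times> V). b q \<noteq> 0 \<longrightarrow> h q = a q / b q))})\<rparr>"

inductive_set alg_generated :: "('p \<Rightarrow> 'k::field) set \<Rightarrow> ('p \<Rightarrow> 'k) set"
  for F :: "('p \<Rightarrow> 'k) set" where
  gen: "f \<in> F \<Longrightarrow> f \<in> alg_generated F"
| const: "(\<lambda>_. c) \<in> alg_generated F"
| add: "f \<in> alg_generated F \<Longrightarrow> g \<in> alg_generated F \<Longrightarrow> (\<lambda>x. f x + g x) \<in> alg_generated F"
| mult: "f \<in> alg_generated F \<Longrightarrow> g \<in> alg_generated F \<Longrightarrow> (\<lambda>x. f x * g x) \<in> alg_generated F"

text \<open>
  Algebra homomorphisms from the functions on \<open>V\<close> belonging to \<open>A\<close> to the ground field. The first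
  condition is needed because elements of \<open>A\<close> that agree on \<open>V\<close> count as the same function.
\<close>

definition alg_hom_on :: "'p set \<Rightarrow> ('p \<Rightarrow> 'k::field) set \<Rightarrow> (('p \<Rightarrow> 'k) \<Rightarrow> 'k) \<Rightarrow> bool" where
  "alg_hom_on V A \<phi> \<longleftrightarrow>
     (\<forall>f\<in>A. \<forall>g\<in>A. (\<forall>x\<in>V. f x = g x) \<longrightarrow> \<phi> f = \<phi> g) \<and>
     (\<forall>c. \<phi> (\<lambda>_. c) = c) \<and>
     (\<forall>f\<in>A. \<forall>g\<in>A. \<phi> (\<lambda>x. f x + g x) = \<phi> f + \<phi> g \<and> \<phi> (\<lambda>x. f x * g x) = \<phi> f * \<phi> g)"

text \<open>
  A space with functions is affine if its algebra of global functions is finitely generated, its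
  points are exactly the algebra homomorphisms to the ground field, and its topology and regular
  functions are those defined by that algebra.
\<close>

definition affine_space :: "('p, 'k::field) fspace \<Rightarrow> bool" where
  "affine_space X \<longleftrightarrow>
     space_with_functions X \<and>
     (let V = points X; A = reg X (points X) in
        (\<exists>F. finite F \<and> F \<subseteq> A \<and> (\<forall>f\<in>A. \<exists>g\<in>alg_generated F. \<forall>x\<in>V. f x = g x)) \<and>
        (\<forall>\<phi>. alg_hom_on V A \<phi> \<longrightarrow> (\<exists>!x. x \<in> V \<and> (\<forall>f\<in>A. \<phi> f = f x))) \<and>
        topol X = topol (alg_space V A) \<and>
        (\<forall>W. openin (topol X) W \<longrightarrow> reg X W = reg (alg_space V A) W))"

text \<open>Varieties are irreducible and separated.\<close>

definition variety :: "('p, 'k::field) fspace \<Rightarrow> bool" where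
  "variety X \<longleftrightarrow>
     space_with_functions X \<and>
     (\<exists>\<U>. finite \<U> \<and> \<Union>\<U> = points X \<and>
          (\<forall>U\<in>\<U>. openin (topol X) U \<and> affine_space (induced X U))) \<and>
     points X \<noteq> {} \<and>
     (\<forall>U V. openin (topol X) U \<longrightarrow> openin (topol X) V \<longrightarrow> U \<noteq> {} \<longrightarrow> V \<noteq> {} \<longrightarrow> U \<inter> V \<noteq> {}) \<and>
     closedin (topol (prod_space X X)) {(x, x) | x. x \<in> points X}"

text \<open>
  Every local ring is integrally closed in the field of rational functions: a rational function
  \<open>f\<close> (with domain of definition containing the nonempty open set \<open>U\<close>) that is a root of a monic
  polynomial with coefficients \<open>a 0, \<dots>, a (d - 1)\<close> regular near \<open>x\<close> is itself regular near \<open>x\<close>.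
\<close>

definition normal_variety :: "('p, 'k::field) fspace \<Rightarrow> bool" where
  "normal_variety X \<longleftrightarrow>
     variety X \<and>
     (\<forall>x\<in>points X. \<forall>U f V a d.
        openin (topol X) U \<and> U \<noteq> {} \<and> f \<in> reg X U \<and>
        openin (topol X) V \<and> x \<in> V \<and> (\<forall>i<d. a i \<in> reg X V) \<and>
        (\<forall>y\<in>U \<inter> V. f y ^ d + (\<Sum>i<d::nat. a i y * f y ^ i) = 0) \<longrightarrow>
        (\<exists>W g. openin (topol X) W \<and> x \<in> W \<and> g \<in> reg X W \<and> (\<forall>y\<in>U \<inter> W. g y = f y)))"

text \<open>An algebraic group is given by a group \<open>G\<close> and a space with functions \<open>S\<close> on its carrier.\<close>

definition regular_action ::
  "('g, 'm) monoid_scheme \<Rightarrow> ('g, 'k::field) fspace \<Rightarrow> ('p, 'k) fspace \<Rightarrow> ('g \<Rightarrow> 'p \<Rightarrow> 'p) \<Rightarrow> bool"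
  where
  "regular_action G S X \<phi> \<longleftrightarrow>
     points S = carrier G \<and>
     group_action G (points X) \<phi> \<and>
     morphism (prod_space S X) X (\<lambda>(g, x). \<phi> g x)"

definition equivariant_embedding ::
  "('g, 'm) monoid_scheme \<Rightarrow> ('g, 'k::field) fspace \<Rightarrow> ('p, 'k) fspace \<Rightarrow> ('g \<Rightarrow> 'p \<Rightarrow> 'p) \<Rightarrow> 'p \<Rightarrow> bool"
  where
  "equivariant_embedding G S X \<phi> x \<longleftrightarrow>
     normal_variety X \<and>
     regular_action G S X \<phi> \<and>
     x \<in> points X \<and>
     stabilizer G \<phi> x = {\<one>\<^bsub>G\<^esub>} \<and>
     openin (topol X) (orbit G \<phi> x) \<and>
     topol X closure_of orbit G \<phi> x = points X"

text \<open>
  The torus of rank \<open>CARD('n)\<close> in coordinates; its character lattice and the dual lattice are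
  both \<open>int ^ 'n\<close>.
\<close>

definition torus :: "('k::field ^ 'n) monoid" where
  "torus = \<lparr>carrier = {t. \<forall>i. t $ i \<noteq> 0}, mult = (\<lambda>t u. \<chi> i. t $ i * u $ i), one = (\<chi> i. 1)\<rparr>"

definition character :: "int ^ 'n \<Rightarrow> 'k::field ^ 'n \<Rightarrow> 'k" where
  "character m t = (\<Prod>i\<in>UNIV. t $ i powi (m $ i))"

text \<open>
  The group algebra of the character lattice is the type \<open>(int ^ 'n) \<Rightarrow>\<^sub>0 'k\<close> with its convolution
  product; this is the function on the torus represented by an element of it.
\<close>

definition laurent_eval :: "((int ^ 'n) \<Rightarrow>\<^sub>0 'k) \<Rightarrow> 'k::field ^ 'n \<Rightarrow> 'k" where
  "laurent_eval p t = (\<Sum>m\<in>Poly_Mapping.keys p. Poly_Mapping.lookup p m * character m t)"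

definition torus_space :: "('k::field ^ 'n, 'k) fspace" where
  "torus_space = alg_space (carrier torus) (range laurent_eval)"

definition mult_group :: "'k::field monoid" where
  "mult_group = \<lparr>carrier = - {0}, mult = (*), one = 1\<rparr>"

definition ker_group :: "int ^ 'n \<Rightarrow> ('k::field ^ 'n) monoid" where
  "ker_group e = torus\<lparr>carrier := kernel torus mult_group (character e)\<rparr>"

definition ker_space :: "int ^ 'n \<Rightarrow> ('k::field ^ 'n, 'k) fspace" where
  "ker_space e = induced torus_space (kernel torus mult_group (character e))"

definition add_group :: "'k::field monoid" where
  "add_group = \<lparr>carrier = UNIV, mult = (+), one = 0\<rparr>"

definition add_group_space :: "('k::field, 'k) fspace" where
  "add_group_space = alg_space UNIV (range poly)"

definition to_rat :: "int ^ 'n \<Rightarrow> rat ^ 'n" where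
  "to_rat v = (\<chi> i. of_int (v $ i))"

text \<open>The pairing of a vector of \<open>N\<close> (\<open>'a = int\<close>) or \<open>N\<^sub>\<rat>\<close> (\<open>'a = rat\<close>) with a vector of \<open>M\<close>.\<close>

definition pairing :: "'a::comm_ring_1 ^ 'n \<Rightarrow> int ^ 'n \<Rightarrow> 'a" where
  "pairing v m = (\<Sum>i\<in>UNIV. v $ i * of_int (m $ i))"

definition cone_gen :: "(rat ^ 'n) set \<Rightarrow> (rat ^ 'n) set" where
  "cone_gen S = {(\<Sum>v\<in>F. c v *s v) | F c. finite F \<and> F \<subseteq> S \<and> (\<forall>v\<in>F. 0 \<le> c v)}"

definition polyhedral_cone :: "(rat ^ 'n) set \<Rightarrow> bool" where
  "polyhedral_cone \<sigma> \<longleftrightarrow> (\<exists>S. finite S \<and> \<sigma> = cone_gen (to_rat ` S))"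

definition strongly_convex :: "(rat ^ 'n) set \<Rightarrow> bool" where
  "strongly_convex \<sigma> \<longleftrightarrow> (\<forall>v. v \<in> \<sigma> \<longrightarrow> - v \<in> \<sigma> \<longrightarrow> v = 0)"

definition dual_lattice_cone :: "(rat ^ 'n) set \<Rightarrow> (int ^ 'n) set" where
  "dual_lattice_cone \<sigma> = {m. \<forall>v\<in>\<sigma>. 0 \<le> pairing v m}"

definition cone_face :: "(rat ^ 'n) set \<Rightarrow> (rat ^ 'n) set \<Rightarrow> bool" where
  "cone_face \<tau> \<sigma> \<longleftrightarrow> (\<exists>u\<in>dual_lattice_cone \<sigma>. \<tau> = {v\<in>\<sigma>. pairing v u = 0})"

definition fan :: "(rat ^ 'n) set set \<Rightarrow> bool" where
  "fan \<Sigma> \<longleftrightarrow>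
     finite \<Sigma> \<and> \<Sigma> \<noteq> {} \<and>
     (\<forall>\<sigma>\<in>\<Sigma>. polyhedral_cone \<sigma> \<and> strongly_convex \<sigma> \<and> (\<forall>\<tau>. cone_face \<tau> \<sigma> \<longrightarrow> \<tau> \<in> \<Sigma>)) \<and>
     (\<forall>\<sigma>\<in>\<Sigma>. \<forall>\<tau>\<in>\<Sigma>. cone_face (\<sigma> \<inter> \<tau>) \<sigma> \<and> cone_face (\<sigma> \<inter> \<tau>) \<tau>)"

definition rays :: "(rat ^ 'n) set set \<Rightarrow> (rat ^ 'n) set set" where
  "rays \<Sigma> = {\<rho>\<in>\<Sigma>. \<exists>v. v \<noteq> 0 \<and> \<rho> = cone_gen {v}}"

definition prim_vec :: "(rat ^ 'n) set \<Rightarrow> int ^ 'n" where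
  "prim_vec \<rho> = (THE v. to_rat v \<in> \<rho> \<and> Gcd (range (\<lambda>i. v $ i)) = 1)"

definition distinguished_ray :: "(rat ^ 'n) set set \<Rightarrow> int ^ 'n \<Rightarrow> (rat ^ 'n) set \<Rightarrow> bool" where
  "distinguished_ray \<Sigma> e \<rho> \<longleftrightarrow>
     \<rho> \<in> rays \<Sigma> \<and>
     pairing (prim_vec \<rho>) e = - 1 \<and>
     (\<forall>\<rho>'\<in>rays \<Sigma>. \<rho>' \<noteq> \<rho> \<longrightarrow> 0 \<le> pairing (prim_vec \<rho>') e) \<and>
     (\<forall>\<sigma>\<in>\<Sigma>. (\<forall>v\<in>\<sigma>. pairing v e = 0) \<longrightarrow> cone_gen (\<sigma> \<union> \<rho>) \<in> \<Sigma>)"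

definition demazure_root :: "(rat ^ 'n) set set \<Rightarrow> int ^ 'n \<Rightarrow> bool" where
  "demazure_root \<Sigma> e \<longleftrightarrow> (\<exists>\<rho>. distinguished_ray \<Sigma> e \<rho>)"

definition root_ray :: "(rat ^ 'n) set set \<Rightarrow> int ^ 'n \<Rightarrow> (rat ^ 'n) set" where
  "root_ray \<Sigma> e = (THE \<rho>. distinguished_ray \<Sigma> e \<rho>)"

definition toric_variety ::
  "('p, 'k::field) fspace \<Rightarrow> ('k ^ 'n \<Rightarrow> 'p \<Rightarrow> 'p) \<Rightarrow> bool" where
  "toric_variety X act \<longleftrightarrow>
     normal_variety X \<and>
     regular_action torus torus_space X act \<and>
     faithful_action torus (points X) act \<and>
     (\<exists>x\<in>points X. openin (topol X) (orbit torus act x))"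

text \<open>
  \<open>p\<close> is an element of the semigroup algebra of the dual cone of \<open>\<sigma>\<close>, and \<open>f\<close> is the regular
  function on \<open>V\<close> corresponding to it when the torus is embedded by \<open>t \<mapsto> t \<cdot> x0\<close>.
\<close>

definition represents ::
  "('p, 'k::field) fspace \<Rightarrow> ('k ^ 'n \<Rightarrow> 'p \<Rightarrow> 'p) \<Rightarrow> 'p \<Rightarrow> (rat ^ 'n) set \<Rightarrow> 'p set \<Rightarrow>
   ('p \<Rightarrow> 'k) \<Rightarrow> ((int ^ 'n) \<Rightarrow>\<^sub>0 'k) \<Rightarrow> bool" where
  "represents X act x0 \<sigma> V f p \<longleftrightarrow>
     f \<in> reg X V \<and> Poly_Mapping.keys p \<subseteq> dual_lattice_cone \<sigma> \<and>
     (\<forall>t\<in>carrier torus. f (act t x0) = laurent_eval p t)"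

text \<open>
  \<open>V\<close> is the affine chart of \<open>\<sigma>\<close>: an invariant affine open set whose coordinate ring is the
  semigroup algebra. The correspondence is one-to-one, as distinct Laurent polynomials are
  distinct functions on the torus and \<open>x0\<close> will be in the dense orbit.
\<close>

definition toric_chart ::
  "('p, 'k::field) fspace \<Rightarrow> ('k ^ 'n \<Rightarrow> 'p \<Rightarrow> 'p) \<Rightarrow> 'p \<Rightarrow> (rat ^ 'n) set \<Rightarrow> 'p set \<Rightarrow> bool" where
  "toric_chart X act x0 \<sigma> V \<longleftrightarrow>
     openin (topol X) V \<and> x0 \<in> V \<and> affine_space (induced X V) \<and>
     (\<forall>t\<in>carrier torus. \<forall>x\<in>V. act t x \<in> V) \<and>
     (\<forall>f\<in>reg X V. \<exists>p. represents X act x0 \<sigma> V f p) \<and>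
     (\<forall>p. Poly_Mapping.keys p \<subseteq> dual_lattice_cone \<sigma> \<longrightarrow> (\<exists>f. represents X act x0 \<sigma> V f p))"

text \<open>
  \<open>\<Sigma>\<close> is the fan of the toric variety \<open>X\<close>: the variety is obtained by gluing the charts \<open>U \<sigma>\<close>
  along the charts of common faces, compatibly with the embedding of the torus given by a base
  point \<open>x0\<close> of the open orbit. The charts do not depend on the choice of \<open>x0\<close>.
\<close>

definition has_fan ::
  "('p, 'k::field) fspace \<Rightarrow> ('k ^ 'n \<Rightarrow> 'p \<Rightarrow> 'p) \<Rightarrow> (rat ^ 'n) set set \<Rightarrow>
   'p \<Rightarrow> ((rat ^ 'n) set \<Rightarrow> 'p set) \<Rightarrow> bool" where
  "has_fan X act \<Sigma> x0 U \<longleftrightarrow>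
     fan \<Sigma> \<and>
     x0 \<in> points X \<and> openin (topol X) (orbit torus act x0) \<and>
     (\<forall>\<sigma>\<in>\<Sigma>. toric_chart X act x0 \<sigma> (U \<sigma>)) \<and>
     (\<Union>\<sigma>\<in>\<Sigma>. U \<sigma>) = points X \<and>
     (\<forall>\<sigma>\<in>\<Sigma>. \<forall>\<tau>\<in>\<Sigma>. U (\<sigma> \<inter> \<tau>) = U \<sigma> \<inter> U \<tau>)"

definition normalized_by_torus ::
  "('p, 'k::field) fspace \<Rightarrow> ('k ^ 'n \<Rightarrow> 'p \<Rightarrow> 'p) \<Rightarrow> ('k \<Rightarrow> 'p \<Rightarrow> 'p) \<Rightarrow> bool" where
  "normalized_by_torus X act \<alpha> \<longleftrightarrow>
     (\<forall>t\<in>carrier torus. \<forall>s. \<exists>s'. \<forall>x\<in>points X. act t (\<alpha> s x) = \<alpha> s' (act t x))"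

text \<open>The derivation \<open>\<chi>\<^sup>m \<mapsto> \<langle>n, m\<rangle> \<chi>\<^sup>m\<^sup>+\<^sup>e\<close>.\<close>

definition root_derivation ::
  "int ^ 'n \<Rightarrow> int ^ 'n \<Rightarrow> ((int ^ 'n) \<Rightarrow>\<^sub>0 'k) \<Rightarrow> ((int ^ 'n) \<Rightarrow>\<^sub>0 'k::field)" where
  "root_derivation n e p =
     (\<Sum>m\<in>Poly_Mapping.keys p.
        Poly_Mapping.single (m + e) (Poly_Mapping.lookup p m * of_int (pairing n m)))"

text \<open>
  The exponential of \<open>s D\<close> at \<open>p\<close>, meaningful if some power of \<open>D\<close> annihilates \<open>p\<close> (otherwise the
  index set is infinite). Powers of \<open>s\<close> enter as constants of the group algebra.
\<close>

definition exp_derivation ::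
  "(((int ^ 'n) \<Rightarrow>\<^sub>0 'k) \<Rightarrow> ((int ^ 'n) \<Rightarrow>\<^sub>0 'k)) \<Rightarrow> 'k \<Rightarrow>
   ((int ^ 'n) \<Rightarrow>\<^sub>0 'k) \<Rightarrow> ((int ^ 'n) \<Rightarrow>\<^sub>0 'k::field_char_0)" where
  "exp_derivation D s p =
     (\<Sum>k | (D ^^ k) p \<noteq> 0. Poly_Mapping.single 0 (s ^ k / fact k) * (D ^^ k) p)"

text \<open>
  The action \<open>\<alpha>\<close> is the one given by the root \<open>e\<close>, up to rescaling of the additive group by a
  nonzero constant \<open>c\<close>: on the charts of the cones containing the distinguished ray, composition
  with \<open>\<alpha> s\<close> is the exponential of \<open>c s\<close> times the derivation, and all other points are fixed.
  The case \<open>c = - 1\<close> covers the convention that \<open>s\<close> acts on functions by composition with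
  \<open>\<alpha> (- s)\<close>.
\<close>

definition represented_by_root ::
  "('p, 'k::field_char_0) fspace \<Rightarrow> ('k ^ 'n \<Rightarrow> 'p \<Rightarrow> 'p) \<Rightarrow> (rat ^ 'n) set set \<Rightarrow>
   'p \<Rightarrow> ((rat ^ 'n) set \<Rightarrow> 'p set) \<Rightarrow> ('k \<Rightarrow> 'p \<Rightarrow> 'p) \<Rightarrow> int ^ 'n \<Rightarrow> bool" where
  "represented_by_root X act \<Sigma> x0 U \<alpha> e \<longleftrightarrow>
     (\<exists>c. c \<noteq> 0 \<and>
        (\<forall>\<sigma>\<in>\<Sigma>. root_ray \<Sigma> e \<subseteq> \<sigma> \<longrightarrow>
           (\<forall>s. \<forall>x\<in>U \<sigma>. \<alpha> s x \<in> U \<sigma>) \<and>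
           (\<forall>s f p. represents X act x0 \<sigma> (U \<sigma>) f p \<longrightarrow>
              represents X act x0 \<sigma> (U \<sigma>) (\<lambda>x. f (\<alpha> s x))
                (exp_derivation (root_derivation (prim_vec (root_ray \<Sigma> e)) e) (c * s) p)))) \<and>
     (\<forall>s. \<forall>x\<in>points X - (\<Union>\<sigma>\<in>{\<sigma>\<in>\<Sigma>. root_ray \<Sigma> e \<subseteq> \<sigma>}. U \<sigma>). \<alpha> s x = x)"

end

theory Submission
  imports Defs
begin

text \<open>
  The embedding takes place inside one chart. Let \<open>\<rho>\<close> be the distinguished ray of the root \<open>e\<close> and
  \<open>n\<close> its primitive vector. As \<open>\<langle>n, e\<rangle> = -1\<close>, the character lattice is the direct sum of
  \<open>\<int>e\<close> and \<open>n\<^sup>\<bottom>\<close>, and the characters that extend to the chart of \<open>\<rho>\<close> are those of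
  \<open>\<nat>(-e) + n\<^sup>\<bottom>\<close>. Hence the chart is a product of the affine line with coordinate \<open>\<chi>\<^sup>-\<^sup>e\<close>
  and the torus with character lattice \<open>n\<^sup>\<bottom>\<close>.

  On these generators the action is explicit. The derivation \<open>\<partial>\<close> of the root kills \<open>\<chi>\<^sup>m\<close> for
  \<open>m \<in> n\<^sup>\<bottom>\<close> and maps \<open>\<chi>\<^sup>-\<^sup>e\<close> to \<open>1\<close>, so that \<open>exp (s\<partial>)\<close> translates the line by \<open>s\<close> and fixes
  the torus factor (\<open>exp_root_derivation_invariant\<close>, \<open>exp_root_derivation_translation\<close>). The kernel
  of \<open>e\<close> fixes \<open>\<chi>\<^sup>-\<^sup>e\<close> and is the torus with character lattice \<open>n\<^sup>\<bottom>\<close>, acting on the second factor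
  by multiplication. So \<open>Ker e \<times> \<bbbG>\<^sub>a\<close> acts simply transitively on the chart
  (\<open>reach_chart\<close>, \<open>trivial_stabilizer\<close>), which is open and, the variety being irreducible, dense.

  The two groups commute on all of \<open>X\<close>: an element \<open>t\<close> of the torus conjugates the action of
  \<open>s\<close> into the action of some \<open>s'\<close>, because the action is normalized, and comparing values of
  \<open>\<chi>\<^sup>-\<^sup>e\<close> at one point of the chart yields \<open>s' = s\<close> if \<open>e(t) = 1\<close> (\<open>commute\<close>).

  Identities between regular functions on the chart are checked on the open torus orbit
  (\<open>agree_on_chart\<close>), and points of the chart are told apart by the functions \<open>\<chi>\<^sup>m\<close>
  (\<open>chart_point_eqI\<close>). That the action of the product is a morphism is formal: it is the composite
  of the two given actions, once the product of spaces with functions is known to have its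
  universal property (\<open>morphism_into_prod\<close>).
\<close>

section \<open>Spaces with functions\<close>

lemma
  assumes "space_with_functions X" "openin (topol X) U"
  shows reg_const: "(\<lambda>_. c) \<in> reg X U"
    and reg_add: "f \<in> reg X U \<Longrightarrow> g \<in> reg X U \<Longrightarrow> (\<lambda>x. f x + g x) \<in> reg X U"
    and reg_mult: "f \<in> reg X U \<Longrightarrow> g \<in> reg X U \<Longrightarrow> (\<lambda>x. f x * g x) \<in> reg X U"
    and reg_cong: "f \<in> reg X U \<Longrightarrow> (\<And>x. x \<in> U \<Longrightarrow> g x = f x) \<Longrightarrow> g \<in> reg X U"
    and open_nonvanishing: "f \<in> reg X U \<Longrightarrow> openin (topol X) {x\<in>U. f x \<noteq> 0}"
    and reg_inverse: "f \<in> reg X U \<Longrightarrow> (\<lambda>x. inverse (f x)) \<in> reg X {x\<in>U. f x \<noteq> 0}"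
proof -
  note * = assms(1)[unfolded space_with_functions_def, THEN conjunct1, THEN spec, THEN mp, OF assms(2)]
  note a = *[THEN conjunct1] and b = *[THEN conjunct2, THEN conjunct1]
    and c = *[THEN conjunct2, THEN conjunct2, THEN conjunct1]
    and d = *[THEN conjunct2, THEN conjunct2, THEN conjunct2]
  show "(\<lambda>_. c) \<in> reg X U" by (rule a[THEN spec])
  show "(\<lambda>x. f x + g x) \<in> reg X U" if "f \<in> reg X U" "g \<in> reg X U"
    using b[THEN bspec, THEN bspec, OF that] by simp
  show "(\<lambda>x. f x * g x) \<in> reg X U" if "f \<in> reg X U" "g \<in> reg X U"
    using b[THEN bspec, THEN bspec, OF that] by simp
  show "g \<in> reg X U" if "f \<in> reg X U" "\<And>x. x \<in> U \<Longrightarrow> g x = f x"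
    using c[THEN bspec, THEN spec, OF that(1), of g] that(2) by simp
  show "openin (topol X) {x\<in>U. f x \<noteq> 0}" "(\<lambda>x. inverse (f x)) \<in> reg X {x\<in>U. f x \<noteq> 0}"
    if "f \<in> reg X U"
    using d[THEN bspec, OF that] by simp_all
qed

lemma reg_Union:
  assumes "space_with_functions X" "\<And>U. U \<in> \<U> \<Longrightarrow> openin (topol X) U"
  shows "f \<in> reg X (\<Union>\<U>) \<longleftrightarrow> (\<forall>U\<in>\<U>. f \<in> reg X U)"
  using assms(1)[unfolded space_with_functions_def, THEN conjunct2, THEN spec, THEN spec, of \<U> f]
    assms(2) by simp

lemma reg_subset:
  assumes "space_with_functions X" "openin (topol X) U" "openin (topol X) V" "V \<subseteq> U" "f \<in> reg X U"
  shows "f \<in> reg X V"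
proof -
  have "f \<in> reg X (\<Union>{U, V}) \<longleftrightarrow> (\<forall>W\<in>{U, V}. f \<in> reg X W)"
    using assms(2,3) by (intro reg_Union[OF assms(1)]) auto
  moreover have "\<Union>{U, V} = U" using assms(4) by auto
  ultimately show ?thesis using assms(5) by simp
qed

text \<open>
  The gluing half of the sheaf condition, in the pointwise form in which regularity is checked below.
\<close>

lemma reg_local:
  assumes X: "space_with_functions X"
    and loc: "\<And>x. x \<in> U \<Longrightarrow> \<exists>V. openin (topol X) V \<and> x \<in> V \<and> V \<subseteq> U \<and> f \<in> reg X V"
  shows "f \<in> reg X U"
proof -
  define \<V> where "\<V> = {V. openin (topol X) V \<and> V \<subseteq> U \<and> f \<in> reg X V}"
  have "f \<in> reg X (\<Union>\<V>) \<longleftrightarrow> (\<forall>V\<in>\<V>. f \<in> reg X V)"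
    by (intro reg_Union[OF X]) (simp add: \<V>_def)
  moreover have "\<Union>\<V> = U" unfolding \<V>_def using loc by blast
  ultimately show ?thesis unfolding \<V>_def by simp
qed

lemma openin_disagreement:
  assumes X: "space_with_functions X" and f: "f \<in> reg X U" and U: "openin (topol X) U"
    and g: "g \<in> reg X U"
  shows "openin (topol X) {x\<in>U. f x \<noteq> g x}"
proof -
  have "(\<lambda>x. f x + (- 1) * g x) \<in> reg X U"
    by (intro reg_add[OF X U f] reg_mult[OF X U _ g] reg_const[OF X U])
  from open_nonvanishing[OF X U this] show ?thesis by simp
qed

section \<open>Structures given by local fractions\<close>

text \<open>
  Both the structure defined by an algebra of functions and the product structure consist of local
  fractions. They are treated together: \<open>D i\<close> is a piece of the space and \<open>A i\<close> the functions
  allowed as numerators and denominators on it. The pieces carry an index because the functions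
  \<open>\<Sum>i. f\<^sub>i(x) g\<^sub>i(y)\<close> depend on \<open>U\<close> and \<open>V\<close> and not only on the set \<open>U \<times> V\<close>, which does not
  determine the factors if it is empty.
\<close>

definition fraction_space ::
  "'i set \<Rightarrow> ('i \<Rightarrow> 'p set) \<Rightarrow> ('i \<Rightarrow> ('p \<Rightarrow> 'k::field) set) \<Rightarrow> ('p, 'k) fspace" where
  "fraction_space I D A =
     \<lparr>topol = topology_generated_by {{x\<in>D i. h x \<noteq> 0} | i h. i \<in> I \<and> h \<in> A i},
      reg = (\<lambda>W. {f. \<forall>x\<in>W. \<exists>i\<in>I. x \<in> D i \<and> (\<exists>a\<in>A i. \<exists>b\<in>A i. b x \<noteq> 0 \<and>
                           (\<forall>y\<in>W \<inter> D i. b y \<noteq> 0 \<longrightarrow> f y = a y / b y))})\<rparr>"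

text \<open>
  Closure under the operations is required only up to equality on \<open>D i\<close>: since \<open>0\<close> has junk negative
  powers, Laurent polynomials multiply as functions on the torus but not on the whole coordinate
  space.
\<close>

locale fraction_data =
  fixes I :: "'i set" and D :: "'i \<Rightarrow> 'p set" and A :: "'i \<Rightarrow> ('p \<Rightarrow> 'k::field) set"
  assumes const: "i \<in> I \<Longrightarrow> \<exists>a\<in>A i. \<forall>x\<in>D i. a x = c"
    and add: "i \<in> I \<Longrightarrow> f \<in> A i \<Longrightarrow> g \<in> A i \<Longrightarrow> \<exists>a\<in>A i. \<forall>x\<in>D i. a x = f x + g x"
    and mult: "i \<in> I \<Longrightarrow> f \<in> A i \<Longrightarrow> g \<in> A i \<Longrightarrow> \<exists>a\<in>A i. \<forall>x\<in>D i. a x = f x * g x"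
    and refine: "i \<in> I \<Longrightarrow> j \<in> I \<Longrightarrow> \<exists>k\<in>I. D k = D i \<inter> D j \<and>
      (\<forall>a\<in>A i \<union> A j. \<exists>b\<in>A k. \<forall>x\<in>D k. b x = a x)"
begin

abbreviation "Y \<equiv> fraction_space I D A"

lemma refineE:
  assumes "i \<in> I" "j \<in> I"
  obtains k where "k \<in> I" "D k = D i \<inter> D j"
    "\<forall>a\<in>A i. \<exists>b\<in>A k. \<forall>x\<in>D k. b x = a x"
    "\<forall>a\<in>A j. \<exists>b\<in>A k. \<forall>x\<in>D k. b x = a x"
  using refine[OF assms] by (elim bexE conjE) simp

text \<open>
  The nonvanishing sets form a base and not just a subbase, since \<open>refine\<close> and \<open>mult\<close> make them
  closed under intersection.
\<close>

lemma openin_iff: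
  "openin (topol Y) W \<longleftrightarrow> (\<forall>x\<in>W. \<exists>i\<in>I. \<exists>h\<in>A i. x \<in> D i \<and> h x \<noteq> 0 \<and> {y\<in>D i. h y \<noteq> 0} \<subseteq> W)"
  (is "_ \<longleftrightarrow> ?R W")
proof
  let ?S = "{{x\<in>D i. h x \<noteq> 0} | i h. i \<in> I \<and> h \<in> A i}"
  assume "openin (topol Y) W"
  then have "generate_topology_on ?S W"
    by (simp add: fraction_space_def openin_topology_generated_by_iff)
  then show "?R W"
  proof induction
    case (Int V W)
    show ?case
    proof
      fix x assume "x \<in> V \<inter> W"
      then have x: "x \<in> V" "x \<in> W" by auto
      obtain i h where ih: "i \<in> I" "h \<in> A i" "x \<in> D i" "h x \<noteq> 0" "{y\<in>D i. h y \<noteq> 0} \<subseteq> V"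
        using bspec[OF Int.IH(1) x(1)] by (elim bexE conjE)
      obtain j g where jg: "j \<in> I" "g \<in> A j" "x \<in> D j" "g x \<noteq> 0" "{y\<in>D j. g y \<noteq> 0} \<subseteq> W"
        using bspec[OF Int.IH(2) x(2)] by (elim bexE conjE)
      obtain k where k: "k \<in> I" "D k = D i \<inter> D j"
        and ki: "\<forall>a\<in>A i. \<exists>b\<in>A k. \<forall>x\<in>D k. b x = a x"
        and kj: "\<forall>a\<in>A j. \<exists>b\<in>A k. \<forall>x\<in>D k. b x = a x"
        using refineE[OF ih(1) jg(1)] .
      obtain h' where h': "h' \<in> A k" "\<forall>x\<in>D k. h' x = h x" using bspec[OF ki ih(2)] by (elim bexE)
      obtain g' where g': "g' \<in> A k" "\<forall>x\<in>D k. g' x = g x" using bspec[OF kj jg(2)] by (elim bexE)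
      obtain r where "r \<in> A k" "\<forall>x\<in>D k. r x = h' x * g' x" using mult[OF k(1) h'(1) g'(1)] by (elim bexE)
      with h' g' have r: "r \<in> A k" "\<forall>x\<in>D k. r x = h x * g x" by auto
      show "\<exists>i\<in>I. \<exists>h\<in>A i. x \<in> D i \<and> h x \<noteq> 0 \<and> {y \<in> D i. h y \<noteq> 0} \<subseteq> V \<inter> W"
        using k(1,2) r ih jg by (intro bexI[of _ k] bexI[of _ r]) auto
    qed
  next
    case (UN K)
    show ?case
    proof
      fix x assume "x \<in> \<Union>K"
      then obtain k where k: "k \<in> K" "x \<in> k" by blast
      obtain i h where "i \<in> I" "h \<in> A i" "x \<in> D i" "h x \<noteq> 0" "{y\<in>D i. h y \<noteq> 0} \<subseteq> k"
        using bspec[OF UN.IH[OF k(1)] k(2)] by (elim bexE conjE)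
      with k(1) show "\<exists>i\<in>I. \<exists>h\<in>A i. x \<in> D i \<and> h x \<noteq> 0 \<and> {y\<in>D i. h y \<noteq> 0} \<subseteq> \<Union>K"
        by (intro bexI[of _ i] bexI[of _ h]) auto
    qed
  next
    case (Basis s)
    then show ?case by blast
  qed simp
next
  assume R: "?R W"
  show "openin (topol Y) W"
  proof (subst openin_subopen, intro ballI)
    fix x assume "x \<in> W"
    with R obtain i h where ih: "i \<in> I" "h \<in> A i" "x \<in> D i" "h x \<noteq> 0" "{y\<in>D i. h y \<noteq> 0} \<subseteq> W"
      by blast
    then have "openin (topol Y) {y\<in>D i. h y \<noteq> 0}"
      by (auto simp: fraction_space_def intro!: topology_generated_by_Basis)
    with ih show "\<exists>T. openin (topol Y) T \<and> x \<in> T \<and> T \<subseteq> W" by blast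
  qed
qed

lemma openinE:
  assumes "openin (topol Y) W" "x \<in> W"
  obtains i h where "i \<in> I" "h \<in> A i" "x \<in> D i" "h x \<noteq> 0" "{y\<in>D i. h y \<noteq> 0} \<subseteq> W"
  using bspec[OF iffD1[OF openin_iff assms(1)] assms(2)] by (elim bexE conjE)

lemma regE:
  assumes "f \<in> reg Y W" "x \<in> W"
  obtains i a b where "i \<in> I" "x \<in> D i" "a \<in> A i" "b \<in> A i" "b x \<noteq> 0"
    "\<forall>y. y \<in> W \<longrightarrow> y \<in> D i \<longrightarrow> b y \<noteq> 0 \<longrightarrow> f y = a y / b y"
proof -
  from assms have "\<exists>i\<in>I. x \<in> D i \<and> (\<exists>a\<in>A i. \<exists>b\<in>A i. b x \<noteq> 0 \<and>
      (\<forall>y\<in>W \<inter> D i. b y \<noteq> 0 \<longrightarrow> f y = a y / b y))"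
    by (simp add: fraction_space_def)
  then show thesis by (elim bexE conjE) (rule that, assumption+, simp)
qed

lemma regI:
  assumes "\<And>x. x \<in> W \<Longrightarrow> \<exists>i a b. i \<in> I \<and> x \<in> D i \<and> a \<in> A i \<and> b \<in> A i \<and> b x \<noteq> 0 \<and>
     (\<forall>y. y \<in> W \<longrightarrow> y \<in> D i \<longrightarrow> b y \<noteq> 0 \<longrightarrow> f y = a y / b y)"
  shows "f \<in> reg Y W"
proof -
  have "\<exists>i\<in>I. x \<in> D i \<and> (\<exists>a\<in>A i. \<exists>b\<in>A i. b x \<noteq> 0 \<and>
     (\<forall>y\<in>W \<inter> D i. b y \<noteq> 0 \<longrightarrow> f y = a y / b y))" if "x \<in> W" for x
  proof -
  from assms[OF that] obtain i a b where *: "i \<in> I" "x \<in> D i" "a \<in> A i" "b \<in> A i" "b x \<noteq> 0"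
    "\<forall>y. y \<in> W \<longrightarrow> y \<in> D i \<longrightarrow> b y \<noteq> 0 \<longrightarrow> f y = a y / b y" by (elim exE conjE)
  show ?thesis
    by (rule bexI[OF _ *(1)], rule conjI[OF *(2)], rule bexI[OF _ *(3)], rule bexI[OF _ *(4)])
      (use *(5,6) in simp)
  qed
  then show ?thesis by (simp add: fraction_space_def)
qed

lemma openin_basic: "i \<in> I \<Longrightarrow> h \<in> A i \<Longrightarrow> openin (topol Y) {x\<in>D i. h x \<noteq> 0}"
  unfolding openin_iff by (intro ballI bexI[of _ i] bexI[of _ h]) auto

lemma openin_D: "i \<in> I \<Longrightarrow> openin (topol Y) (D i)"
proof -
  assume i: "i \<in> I"
  obtain a where a: "a \<in> A i" "\<forall>x\<in>D i. a x = 1" using const[OF i, of 1] by (elim bexE)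
  then have "{x\<in>D i. a x \<noteq> 0} = D i" by auto
  with openin_basic[OF i a(1)] show ?thesis by simp
qed

lemma points_fraction_space: "points Y = (\<Union>i\<in>I. D i)"
proof
  show "points Y \<subseteq> (\<Union>i\<in>I. D i)" by (auto simp: points_def fraction_space_def)
  show "(\<Union>i\<in>I. D i) \<subseteq> points Y" unfolding points_def using openin_D openin_subset by blast
qed

lemma common_denominator:
  assumes "f \<in> reg Y W" "g \<in> reg Y W" "x \<in> W"
  obtains i a a' b where "i \<in> I" "x \<in> D i" "a \<in> A i" "a' \<in> A i" "b \<in> A i" "b x \<noteq> 0"
    "\<forall>y. y \<in> W \<longrightarrow> y \<in> D i \<longrightarrow> b y \<noteq> 0 \<longrightarrow> f y = a y / b y \<and> g y = a' y / b y"
proof -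
  obtain i a b where f: "i \<in> I" "x \<in> D i" "a \<in> A i" "b \<in> A i" "b x \<noteq> 0"
    "\<forall>y. y \<in> W \<longrightarrow> y \<in> D i \<longrightarrow> b y \<noteq> 0 \<longrightarrow> f y = a y / b y"
    using regE[OF assms(1,3)] .
  obtain j a' b' where g: "j \<in> I" "x \<in> D j" "a' \<in> A j" "b' \<in> A j" "b' x \<noteq> 0"
    "\<forall>y. y \<in> W \<longrightarrow> y \<in> D j \<longrightarrow> b' y \<noteq> 0 \<longrightarrow> g y = a' y / b' y"
    using regE[OF assms(2,3)] .
  obtain k where k: "k \<in> I" "D k = D i \<inter> D j"
    and ki: "\<forall>a\<in>A i. \<exists>b\<in>A k. \<forall>x\<in>D k. b x = a x"
    and kj: "\<forall>a\<in>A j. \<exists>b\<in>A k. \<forall>x\<in>D k. b x = a x"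
    using refineE[OF f(1) g(1)] .
  obtain a1 where a1: "a1 \<in> A k" "\<forall>x\<in>D k. a1 x = a x" using bspec[OF ki f(3)] by (elim bexE)
  obtain b1 where b1: "b1 \<in> A k" "\<forall>x\<in>D k. b1 x = b x" using bspec[OF ki f(4)] by (elim bexE)
  obtain a2 where a2: "a2 \<in> A k" "\<forall>x\<in>D k. a2 x = a' x" using bspec[OF kj g(3)] by (elim bexE)
  obtain b2 where b2: "b2 \<in> A k" "\<forall>x\<in>D k. b2 x = b' x" using bspec[OF kj g(4)] by (elim bexE)
  obtain n where n: "n \<in> A k" "\<forall>x\<in>D k. n x = a1 x * b2 x"
    using mult[OF k(1) a1(1) b2(1)] by (elim bexE)
  obtain n' where n': "n' \<in> A k" "\<forall>x\<in>D k. n' x = a2 x * b1 x"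
    using mult[OF k(1) a2(1) b1(1)] by (elim bexE)
  obtain d where d: "d \<in> A k" "\<forall>x\<in>D k. d x = b1 x * b2 x"
    using mult[OF k(1) b1(1) b2(1)] by (elim bexE)
  show thesis
  proof (rule that[OF k(1) _ n(1) n'(1) d(1)])
    show xk: "x \<in> D k" using f(2) g(2) k(2) by simp
    show "d x \<noteq> 0" using xk d b1 b2 f(5) g(5) by simp
    have "f y = n y / d y \<and> g y = n' y / d y" if y: "y \<in> W" "y \<in> D k" "d y \<noteq> 0" for y
    proof -
      have "b y \<noteq> 0" "b' y \<noteq> 0" using y d b1 b2 by auto
      with y show ?thesis
        using f(6)[rule_format, of y] g(6)[rule_format, of y] k(2) n n' d a1 b1 a2 b2 by auto
    qed
    then show "\<forall>y. y \<in> W \<longrightarrow> y \<in> D k \<longrightarrow> d y \<noteq> 0 \<longrightarrow> f y = n y / d y \<and> g y = n' y / d y"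
      by simp
  qed
qed

lemma space_with_functions: "space_with_functions Y"
  unfolding space_with_functions_def
proof (intro conjI allI impI ballI)
  fix W c assume W: "openin (topol Y) W"
  show "(\<lambda>_. c) \<in> reg Y W"
  proof (rule regI)
    fix x assume "x \<in> W"
    from openinE[OF W this] obtain i where i: "i \<in> I" "x \<in> D i" .
    obtain a where "a \<in> A i" "\<forall>y\<in>D i. a y = c" using const[OF i(1), of c] by (elim bexE)
    moreover obtain b where "b \<in> A i" "\<forall>y\<in>D i. b y = 1" using const[OF i(1), of 1] by (elim bexE)
    ultimately show "\<exists>i a b. i \<in> I \<and> x \<in> D i \<and> a \<in> A i \<and> b \<in> A i \<and> b x \<noteq> 0 \<and>
        (\<forall>y. y \<in> W \<longrightarrow> y \<in> D i \<longrightarrow> b y \<noteq> 0 \<longrightarrow> c = a y / b y)"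
      using i by (intro exI[of _ i] exI[of _ a] exI[of _ b]) simp
  qed
next
  fix W f g assume W: "openin (topol Y) W" and fg: "f \<in> reg Y W" "g \<in> reg Y W"
  show "(\<lambda>x. f x + g x) \<in> reg Y W"
  proof (rule regI)
    fix x assume "x \<in> W"
    from common_denominator[OF fg this] obtain i a a' b where *: "i \<in> I" "x \<in> D i" "a \<in> A i"
      "a' \<in> A i" "b \<in> A i" "b x \<noteq> 0"
      "\<forall>y. y \<in> W \<longrightarrow> y \<in> D i \<longrightarrow> b y \<noteq> 0 \<longrightarrow> f y = a y / b y \<and> g y = a' y / b y" .
    obtain n where "n \<in> A i" "\<forall>y\<in>D i. n y = a y + a' y" using add[OF *(1,3,4)] by (elim bexE)
    with * show "\<exists>i a b. i \<in> I \<and> x \<in> D i \<and> a \<in> A i \<and> b \<in> A i \<and> b x \<noteq> 0 \<and>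
        (\<forall>y. y \<in> W \<longrightarrow> y \<in> D i \<longrightarrow> b y \<noteq> 0 \<longrightarrow> f y + g y = a y / b y)"
      by (intro exI[of _ i] exI[of _ n] exI[of _ b]) (simp add: add_divide_distrib)
  qed
  show "(\<lambda>x. f x * g x) \<in> reg Y W"
  proof (rule regI)
    fix x assume "x \<in> W"
    from common_denominator[OF fg this] obtain i a a' b where *: "i \<in> I" "x \<in> D i" "a \<in> A i"
      "a' \<in> A i" "b \<in> A i" "b x \<noteq> 0"
      "\<forall>y. y \<in> W \<longrightarrow> y \<in> D i \<longrightarrow> b y \<noteq> 0 \<longrightarrow> f y = a y / b y \<and> g y = a' y / b y" .
    obtain n where n: "n \<in> A i" "\<forall>y\<in>D i. n y = a y * a' y" using mult[OF *(1,3,4)] by (elim bexE)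
    obtain d where d: "d \<in> A i" "\<forall>y\<in>D i. d y = b y * b y" using mult[OF *(1,5,5)] by (elim bexE)
    from * n d show "\<exists>i a b. i \<in> I \<and> x \<in> D i \<and> a \<in> A i \<and> b \<in> A i \<and> b x \<noteq> 0 \<and>
        (\<forall>y. y \<in> W \<longrightarrow> y \<in> D i \<longrightarrow> b y \<noteq> 0 \<longrightarrow> f y * g y = a y / b y)"
      by (intro exI[of _ i] exI[of _ n] exI[of _ d]) simp
  qed
next
  fix W f g assume f: "f \<in> reg Y W" and eq: "\<forall>x\<in>W. g x = f x"
  show "g \<in> reg Y W"
  proof (rule regI)
    fix x assume "x \<in> W"
    from regE[OF f this] obtain i a b where "i \<in> I" "x \<in> D i" "a \<in> A i" "b \<in> A i" "b x \<noteq> 0"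
      "\<forall>y. y \<in> W \<longrightarrow> y \<in> D i \<longrightarrow> b y \<noteq> 0 \<longrightarrow> f y = a y / b y" .
    then show "\<exists>i a b. i \<in> I \<and> x \<in> D i \<and> a \<in> A i \<and> b \<in> A i \<and> b x \<noteq> 0 \<and>
        (\<forall>y. y \<in> W \<longrightarrow> y \<in> D i \<longrightarrow> b y \<noteq> 0 \<longrightarrow> g y = a y / b y)"
      using eq by (intro exI[of _ i] exI[of _ a] exI[of _ b]) simp
  qed
next
  fix W f assume W: "openin (topol Y) W" and f: "f \<in> reg Y W"
  \<comment> \<open>The product \<open>r\<close> is nonzero only where the fraction is defined and nonzero.\<close>
  have num: "\<exists>i a b r. i \<in> I \<and> x \<in> D i \<and> a \<in> A i \<and> b \<in> A i \<and> r \<in> A i \<and>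
      (\<forall>y\<in>D i. r y = a y * b y) \<and> r x \<noteq> 0 \<and>
      (\<forall>y. y \<in> W \<longrightarrow> y \<in> D i \<longrightarrow> b y \<noteq> 0 \<longrightarrow> f y = a y / b y)" if x: "x \<in> W" "f x \<noteq> 0" for x
  proof -
    from regE[OF f x(1)] obtain i a b where *: "i \<in> I" "x \<in> D i" "a \<in> A i" "b \<in> A i" "b x \<noteq> 0"
      "\<forall>y. y \<in> W \<longrightarrow> y \<in> D i \<longrightarrow> b y \<noteq> 0 \<longrightarrow> f y = a y / b y" .
    obtain r where r: "r \<in> A i" "\<forall>y\<in>D i. r y = a y * b y" using mult[OF *(1,3,4)] by (elim bexE)
    have "r x \<noteq> 0" using * r x by auto
    with * r show ?thesis by (intro exI[of _ i] exI[of _ a] exI[of _ b] exI[of _ r]) simp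
  qed
  show "openin (topol Y) {x\<in>W. f x \<noteq> 0}"
  proof (subst openin_subopen, intro ballI)
    fix x assume "x \<in> {x\<in>W. f x \<noteq> 0}"
    then have x: "x \<in> W" "f x \<noteq> 0" by auto
    obtain i a b r where *: "i \<in> I" "x \<in> D i" "a \<in> A i" "b \<in> A i" "r \<in> A i"
      "\<forall>y\<in>D i. r y = a y * b y" "r x \<noteq> 0"
      "\<forall>y. y \<in> W \<longrightarrow> y \<in> D i \<longrightarrow> b y \<noteq> 0 \<longrightarrow> f y = a y / b y"
      using num[OF x] by (elim exE conjE)
    have "openin (topol Y) (W \<inter> {y\<in>D i. r y \<noteq> 0})" by (rule openin_Int[OF W openin_basic[OF *(1,5)]])
    moreover have "x \<in> W \<inter> {y\<in>D i. r y \<noteq> 0}" using * x by simp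
    moreover have "W \<inter> {y\<in>D i. r y \<noteq> 0} \<subseteq> {x\<in>W. f x \<noteq> 0}" using *(6,8) by auto
    ultimately show "\<exists>T. openin (topol Y) T \<and> x \<in> T \<and> T \<subseteq> {x \<in> W. f x \<noteq> 0}"
      by (intro exI[of _ "W \<inter> {y\<in>D i. r y \<noteq> 0}"]) simp
  qed
  show "(\<lambda>x. inverse (f x)) \<in> reg Y {x\<in>W. f x \<noteq> 0}"
  proof (rule regI)
    fix x assume "x \<in> {x\<in>W. f x \<noteq> 0}"
    then have x: "x \<in> W" "f x \<noteq> 0" by auto
    obtain i a b r where *: "i \<in> I" "x \<in> D i" "a \<in> A i" "b \<in> A i" "r \<in> A i"
      "\<forall>y\<in>D i. r y = a y * b y" "r x \<noteq> 0"
      "\<forall>y. y \<in> W \<longrightarrow> y \<in> D i \<longrightarrow> b y \<noteq> 0 \<longrightarrow> f y = a y / b y"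
      using num[OF x] by (elim exE conjE)
    obtain d where d: "d \<in> A i" "\<forall>y\<in>D i. d y = b y * b y" using mult[OF *(1,4,4)] by (elim bexE)
    have "inverse (f y) = d y / r y" if "y \<in> W" "y \<in> D i" "r y \<noteq> 0" for y
      using that *(6,8) d by simp
    with * d show "\<exists>i a b. i \<in> I \<and> x \<in> D i \<and> a \<in> A i \<and> b \<in> A i \<and> b x \<noteq> 0 \<and>
        (\<forall>y. y \<in> {x\<in>W. f x \<noteq> 0} \<longrightarrow> y \<in> D i \<longrightarrow> b y \<noteq> 0 \<longrightarrow> inverse (f y) = a y / b y)"
      by (intro exI[of _ i] exI[of _ d] exI[of _ r]) simp
  qed
next
  fix \<U> f assume \<U>: "\<forall>U\<in>\<U>. openin (topol Y) U"
  show "f \<in> reg Y (\<Union>\<U>) \<longleftrightarrow> (\<forall>U\<in>\<U>. f \<in> reg Y U)"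
  proof
    assume f: "f \<in> reg Y (\<Union>\<U>)"
    show "\<forall>U\<in>\<U>. f \<in> reg Y U"
    proof (intro ballI regI)
      fix U x assume U: "U \<in> \<U>" and x: "x \<in> U"
      from x U have "x \<in> \<Union>\<U>" by auto
      from regE[OF f this] obtain i a b where "i \<in> I" "x \<in> D i" "a \<in> A i" "b \<in> A i" "b x \<noteq> 0"
        "\<forall>y. y \<in> \<Union>\<U> \<longrightarrow> y \<in> D i \<longrightarrow> b y \<noteq> 0 \<longrightarrow> f y = a y / b y" .
      then show "\<exists>i a b. i \<in> I \<and> x \<in> D i \<and> a \<in> A i \<and> b \<in> A i \<and> b x \<noteq> 0 \<and>
          (\<forall>y. y \<in> U \<longrightarrow> y \<in> D i \<longrightarrow> b y \<noteq> 0 \<longrightarrow> f y = a y / b y)"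
        using U by (intro exI[of _ i] exI[of _ a] exI[of _ b]) auto
    qed
  next
    assume R: "\<forall>U\<in>\<U>. f \<in> reg Y U"
    show "f \<in> reg Y (\<Union>\<U>)"
    proof (rule regI)
      fix x assume "x \<in> \<Union>\<U>"
      then obtain W where W: "W \<in> \<U>" "x \<in> W" by blast
      from regE[OF bspec[OF R W(1)] W(2)] obtain i a b
        where f: "i \<in> I" "x \<in> D i" "a \<in> A i" "b \<in> A i" "b x \<noteq> 0"
          "\<forall>y. y \<in> W \<longrightarrow> y \<in> D i \<longrightarrow> b y \<noteq> 0 \<longrightarrow> f y = a y / b y" .
      from openinE[OF bspec[OF \<U> W(1)] W(2)] obtain j h
        where h: "j \<in> I" "h \<in> A j" "x \<in> D j" "h x \<noteq> 0" "{y\<in>D j. h y \<noteq> 0} \<subseteq> W" .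
      obtain k where k: "k \<in> I" "D k = D i \<inter> D j"
        and ki: "\<forall>a\<in>A i. \<exists>b\<in>A k. \<forall>x\<in>D k. b x = a x"
        and kj: "\<forall>a\<in>A j. \<exists>b\<in>A k. \<forall>x\<in>D k. b x = a x"
        using refineE[OF f(1) h(1)] .
      obtain a1 where a1: "a1 \<in> A k" "\<forall>x\<in>D k. a1 x = a x" using bspec[OF ki f(3)] by (elim bexE)
      obtain b1 where b1: "b1 \<in> A k" "\<forall>x\<in>D k. b1 x = b x" using bspec[OF ki f(4)] by (elim bexE)
      obtain h1 where h1: "h1 \<in> A k" "\<forall>x\<in>D k. h1 x = h x" using bspec[OF kj h(2)] by (elim bexE)
      \<comment> \<open>Multiplying numerator and denominator by \<open>h\<close> confines the fraction to \<open>W\<close>.\<close>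
      obtain n where n: "n \<in> A k" "\<forall>x\<in>D k. n x = a1 x * h1 x"
        using mult[OF k(1) a1(1) h1(1)] by (elim bexE)
      obtain d where d: "d \<in> A k" "\<forall>x\<in>D k. d x = b1 x * h1 x"
        using mult[OF k(1) b1(1) h1(1)] by (elim bexE)
      have "x \<in> D k" "d x \<noteq> 0" using f h k d b1 h1 by auto
      moreover have "f y = n y / d y" if y: "y \<in> D k" "d y \<noteq> 0" for y
      proof -
        have "h y \<noteq> 0" "b y \<noteq> 0" using y d b1 h1 by auto
        moreover from this have "y \<in> W" using y k h(5) by auto
        ultimately show ?thesis using f(6)[rule_format, of y] y k n d a1 b1 h1 by auto
      qed
      ultimately show "\<exists>i a b. i \<in> I \<and> x \<in> D i \<and> a \<in> A i \<and> b \<in> A i \<and> b x \<noteq> 0 \<and>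
          (\<forall>y. y \<in> \<Union>\<U> \<longrightarrow> y \<in> D i \<longrightarrow> b y \<noteq> 0 \<longrightarrow> f y = a y / b y)"
        using k n d by (intro exI[of _ k] exI[of _ n] exI[of _ d]) simp
    qed
  qed
qed

text \<open>
  Regularity of a map into a space of local fractions needs to be tested only on numerators and
  denominators, because fractions of regular functions are regular where the denominator does not
  vanish.
\<close>

lemma morphism_into:
  assumes Z: "space_with_functions Z"
    and pts: "\<And>z. z \<in> points Z \<Longrightarrow> \<theta> z \<in> (\<Union>i\<in>I. D i)"
    and opn: "\<And>i. i \<in> I \<Longrightarrow> openin (topol Z) {z\<in>points Z. \<theta> z \<in> D i}"
    and pull: "\<And>i a. i \<in> I \<Longrightarrow> a \<in> A i \<Longrightarrow> (\<lambda>z. a (\<theta> z)) \<in> reg Z {z\<in>points Z. \<theta> z \<in> D i}"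
  shows "morphism Z Y \<theta>"
proof -
  have basic: "openin (topol Z) {z\<in>points Z. \<theta> z \<in> D i \<and> h (\<theta> z) \<noteq> 0}" if "i \<in> I" "h \<in> A i" for i h
    using open_nonvanishing[OF Z opn[OF that(1)] pull[OF that]]
    by (rule back_subst) auto
  have cont: "continuous_map (topol Z) (topol Y) \<theta>"
    unfolding continuous_map
  proof (intro conjI allI impI)
    show "\<theta> ` topspace (topol Z) \<subseteq> topspace (topol Y)"
      using pts points_fraction_space unfolding points_def by blast
    fix W assume W: "openin (topol Y) W"
    show "openin (topol Z) {z \<in> topspace (topol Z). \<theta> z \<in> W}"
    proof (subst openin_subopen, intro ballI)
      fix z assume z: "z \<in> {z \<in> topspace (topol Z). \<theta> z \<in> W}"
      then have "\<theta> z \<in> W" by simp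
      from openinE[OF W this] obtain i h
        where "i \<in> I" "h \<in> A i" "\<theta> z \<in> D i" "h (\<theta> z) \<noteq> 0" "{y\<in>D i. h y \<noteq> 0} \<subseteq> W" .
      with z basic[of i h] show "\<exists>T. openin (topol Z) T \<and> z \<in> T \<and> T \<subseteq> {z \<in> topspace (topol Z). \<theta> z \<in> W}"
        unfolding points_def by (intro exI[of _ "{z \<in> topspace (topol Z). \<theta> z \<in> D i \<and> h (\<theta> z) \<noteq> 0}"]) auto
    qed
  qed
  have "(\<lambda>z. f (\<theta> z)) \<in> reg Z {z\<in>points Z. \<theta> z \<in> W}" if W: "openin (topol Y) W" and f: "f \<in> reg Y W" for W f
  proof (rule reg_local[OF Z])
    fix z assume z: "z \<in> {z\<in>points Z. \<theta> z \<in> W}"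
    then have "\<theta> z \<in> W" by simp
    from regE[OF f this] obtain i a b
      where *: "i \<in> I" "\<theta> z \<in> D i" "a \<in> A i" "b \<in> A i" "b (\<theta> z) \<noteq> 0"
        "\<forall>y. y \<in> W \<longrightarrow> y \<in> D i \<longrightarrow> b y \<noteq> 0 \<longrightarrow> f y = a y / b y" .
    let ?W = "{z\<in>points Z. \<theta> z \<in> W}"
    have oW: "openin (topol Z) ?W"
      using cont W unfolding continuous_map points_def by blast
    let ?E = "{z\<in>points Z. \<theta> z \<in> D i}"
    let ?N = "{z\<in>?E. b (\<theta> z) \<noteq> 0}"
    have oN: "openin (topol Z) ?N" by (rule open_nonvanishing[OF Z opn[OF *(1)] pull[OF *(1,4)]])
    then have o: "openin (topol Z) (?N \<inter> ?W)" using oW by (rule openin_Int)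
    have "(\<lambda>z. a (\<theta> z) * inverse (b (\<theta> z))) \<in> reg Z ?N"
      by (intro reg_mult[OF Z oN] reg_inverse[OF Z opn[OF *(1)] pull[OF *(1,4)]]
          reg_subset[OF Z opn[OF *(1)] oN _ pull[OF *(1,3)]]) auto
    then have "(\<lambda>z. a (\<theta> z) * inverse (b (\<theta> z))) \<in> reg Z (?N \<inter> ?W)"
      by (rule reg_subset[OF Z oN o Int_lower1])
    then have "(\<lambda>z. f (\<theta> z)) \<in> reg Z (?N \<inter> ?W)"
      by (rule reg_cong[OF Z o]) (use * in \<open>auto simp: divide_inverse\<close>)
    with z * o show "\<exists>V. openin (topol Z) V \<and> z \<in> V \<and> V \<subseteq> ?W \<and> (\<lambda>z. f (\<theta> z)) \<in> reg Z V"
      by (intro exI[of _ "?N \<inter> ?W"]) auto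
  qed
  with cont show ?thesis unfolding morphism_def by blast
qed

end

text \<open>
  Used for two descriptions of the same structure by fractions that agree on open sets only.
\<close>

lemma space_with_functions_cong:
  assumes X: "space_with_functions X" and top: "topol Y = topol X"
    and reg: "\<And>W. openin (topol X) W \<Longrightarrow> reg Y W = reg X W"
  shows "space_with_functions Y"
  unfolding space_with_functions_def top
proof (intro conjI allI impI ballI)
  fix U assume U: "openin (topol X) U"
  show "(\<lambda>_. c) \<in> reg Y U" for c using reg_const[OF X U] by (simp add: reg U)
  show "g \<in> reg Y U" if "f \<in> reg Y U" "\<forall>x\<in>U. g x = f x" for f g
    using reg_cong[OF X U, of f g] that by (simp add: reg U)
  fix f assume "f \<in> reg Y U"
  then have f: "f \<in> reg X U" by (simp add: reg U)
  show "(\<lambda>x. f x + g x) \<in> reg Y U" "(\<lambda>x. f x * g x) \<in> reg Y U" if "g \<in> reg Y U" for g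
    using reg_add[OF X U f, of g] reg_mult[OF X U f, of g] that by (simp_all add: reg U)
  show o: "openin (topol X) {x\<in>U. f x \<noteq> 0}" by (rule open_nonvanishing[OF X U f])
  show "(\<lambda>x. inverse (f x)) \<in> reg Y {x\<in>U. f x \<noteq> 0}"
    using reg_inverse[OF X U f] by (simp add: reg o)
next
  fix \<U> f assume \<U>: "\<forall>U\<in>\<U>. openin (topol X) U"
  then have "openin (topol X) (\<Union>\<U>)" by auto
  then show "f \<in> reg Y (\<Union>\<U>) \<longleftrightarrow> (\<forall>U\<in>\<U>. f \<in> reg Y U)"
    using reg_Union[OF X, of \<U> f] \<U> by (simp add: reg)
qed

section \<open>The structure defined by an algebra\<close>

lemma
  fixes A :: "('p \<Rightarrow> 'k::field) set"
  assumes const: "\<And>c. \<exists>a\<in>A. \<forall>x\<in>V. a x = c"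
    and add: "\<And>f g. f \<in> A \<Longrightarrow> g \<in> A \<Longrightarrow> \<exists>a\<in>A. \<forall>x\<in>V. a x = f x + g x"
    and mult: "\<And>f g. f \<in> A \<Longrightarrow> g \<in> A \<Longrightarrow> \<exists>a\<in>A. \<forall>x\<in>V. a x = f x * g x"
  shows space_with_functions_alg_space: "space_with_functions (alg_space V A)"
    and points_alg_space: "points (alg_space V A) = V"
proof -
  interpret fraction_data "{()}" "\<lambda>_. V" "\<lambda>_. A"
    by unfold_locales (use assms in auto)
  have top: "topol (alg_space V A) = topol Y"
    unfolding alg_space_def fraction_space_def by (simp add: image_def Bex_def conj_commute)
  show "space_with_functions (alg_space V A)"
  proof (rule space_with_functions_cong[OF space_with_functions top])
    fix W assume "openin (topol Y) W"
    then have "W \<subseteq> V" using openin_subset points_fraction_space unfolding points_def by fastforce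
    then show "reg (alg_space V A) W = reg Y W"
      unfolding alg_space_def fraction_space_def by (auto simp: Int_absorb2 subset_iff)
  qed
  show "points (alg_space V A) = V"
    using points_fraction_space unfolding points_def top by simp
qed

section \<open>Morphisms\<close>

lemma openin_points: "openin (topol X) (points X)"
  by (simp add: points_def)

lemma openin_subset_points: "openin (topol X) U \<Longrightarrow> U \<subseteq> points X"
  unfolding points_def by (rule openin_subset)

lemma morphismI:
  assumes "\<And>x. x \<in> points X \<Longrightarrow> \<phi> x \<in> points Y"
    and "\<And>V. openin (topol Y) V \<Longrightarrow> openin (topol X) {x\<in>points X. \<phi> x \<in> V}"
    and "\<And>V f. openin (topol Y) V \<Longrightarrow> f \<in> reg Y V \<Longrightarrow> (\<lambda>x. f (\<phi> x)) \<in> reg X {x\<in>points X. \<phi> x \<in> V}"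
  shows "morphism X Y \<phi>"
  using assms unfolding morphism_def continuous_map points_def by (auto simp: image_subset_iff)

lemma reg_pullback:
  "morphism X Y \<phi> \<Longrightarrow> openin (topol Y) V \<Longrightarrow> f \<in> reg Y V \<Longrightarrow>
    (\<lambda>x. f (\<phi> x)) \<in> reg X {x\<in>points X. \<phi> x \<in> V}"
  unfolding morphism_def by simp

lemma morphism_points: "morphism X Y \<phi> \<Longrightarrow> x \<in> points X \<Longrightarrow> \<phi> x \<in> points Y"
  unfolding morphism_def points_def continuous_map by (auto simp: image_subset_iff)

lemma openin_preimage_morphism:
  "morphism X Y \<phi> \<Longrightarrow> openin (topol Y) V \<Longrightarrow> openin (topol X) {x\<in>points X. \<phi> x \<in> V}"
  unfolding morphism_def continuous_map points_def by simp

lemma morphism_compose: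
  assumes \<phi>: "morphism X Y \<phi>" and \<psi>: "morphism Y Z \<psi>"
  shows "morphism X Z (\<lambda>x. \<psi> (\<phi> x))"
proof (rule morphismI)
  show "\<psi> (\<phi> x) \<in> points Z" if "x \<in> points X" for x
    by (rule morphism_points[OF \<psi> morphism_points[OF \<phi> that]])
  fix V assume V: "openin (topol Z) V"
  have eq: "{x\<in>points X. \<phi> x \<in> {y\<in>points Y. \<psi> y \<in> V}} = {x\<in>points X. \<psi> (\<phi> x) \<in> V}"
    using morphism_points[OF \<phi>] by auto
  note o = openin_preimage_morphism[OF \<psi> V]
  show "openin (topol X) {x\<in>points X. \<psi> (\<phi> x) \<in> V}"
    using openin_preimage_morphism[OF \<phi> o] unfolding eq .
  show "(\<lambda>x. f (\<psi> (\<phi> x))) \<in> reg X {x\<in>points X. \<psi> (\<phi> x) \<in> V}" if "f \<in> reg Z V" for f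
    using reg_pullback[OF \<phi> o reg_pullback[OF \<psi> V that]] unfolding eq .
qed

lemma morphism_cong:
  assumes X: "space_with_functions X" and \<phi>: "morphism X Y \<phi>"
    and eq: "\<And>x. x \<in> points X \<Longrightarrow> \<psi> x = \<phi> x"
  shows "morphism X Y \<psi>"
proof (rule morphismI)
  show "\<psi> x \<in> points Y" if "x \<in> points X" for x using morphism_points[OF \<phi> that] eq[OF that] by simp
  fix V assume V: "openin (topol Y) V"
  have eqV: "{x\<in>points X. \<psi> x \<in> V} = {x\<in>points X. \<phi> x \<in> V}" using eq by auto
  note o = openin_preimage_morphism[OF \<phi> V]
  show "openin (topol X) {x\<in>points X. \<psi> x \<in> V}" unfolding eqV by (rule o)
  show "(\<lambda>x. f (\<psi> x)) \<in> reg X {x \<in> points X. \<psi> x \<in> V}" if "f \<in> reg Y V" for f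
    unfolding eqV by (rule reg_cong[OF X o reg_pullback[OF \<phi> V that]]) (simp add: eq)
qed

lemma morphism_const:
  assumes X: "space_with_functions X" and y: "y \<in> points Y"
  shows "morphism X Y (\<lambda>_. y)"
proof (rule morphismI)
  show "y \<in> points Y" by (rule y)
  fix V
  show o: "openin (topol X) {x\<in>points X. y \<in> V}" unfolding points_def by (cases "y \<in> V") simp_all
  show "(\<lambda>_. f y) \<in> reg X {x\<in>points X. y \<in> V}" for f by (rule reg_const[OF X o])
qed

lemma morphism_id: "morphism X X (\<lambda>x. x)"
proof (rule morphismI)
  fix V assume V: "openin (topol X) V"
  then have eq: "{x\<in>points X. x \<in> V} = V" using openin_subset[OF V] by (auto simp: points_def)
  show "openin (topol X) {x\<in>points X. x \<in> V}" unfolding eq by (rule V)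
  show "f \<in> reg X {x\<in>points X. x \<in> V}" if "f \<in> reg X V" for f unfolding eq by (rule that)
qed

section \<open>Products\<close>

lemma tensor_funs_simple:
  assumes "f \<in> reg X U" "g \<in> reg Y V"
  shows "(\<lambda>(x, y). f x * g y) \<in> tensor_funs X Y U V"
  unfolding tensor_funs_def
  using assms by (intro CollectI exI[of _ "1::nat"] exI[of _ "\<lambda>_. f"] exI[of _ "\<lambda>_. g"]) auto

lemma tensor_funs_0: "(\<lambda>_. 0) \<in> tensor_funs X Y U V"
  unfolding tensor_funs_def by (intro CollectI exI[of _ "0::nat"]) auto

lemma tensor_funs_add:
  assumes "h \<in> tensor_funs X Y U V" "h' \<in> tensor_funs X Y U V"
  shows "(\<lambda>p. h p + h' p) \<in> tensor_funs X Y U V"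
proof -
  obtain r :: nat and f g where h: "h = (\<lambda>(x, y). \<Sum>i<r. f i x * g i y)"
    "\<forall>i<r. f i \<in> reg X U" "\<forall>i<r. g i \<in> reg Y V"
    using assms(1) unfolding tensor_funs_def by blast
  obtain r' :: nat and f' g' where h': "h' = (\<lambda>(x, y). \<Sum>i<r'. f' i x * g' i y)"
    "\<forall>i<r'. f' i \<in> reg X U" "\<forall>i<r'. g' i \<in> reg Y V"
    using assms(2) unfolding tensor_funs_def by blast
  let ?f = "\<lambda>i. if i < r then f i else f' (i - r)"
  let ?g = "\<lambda>i. if i < r then g i else g' (i - r)"
  have "(\<Sum>i<r + r'. ?f i x * ?g i y) = (\<Sum>i<r. f i x * g i y) + (\<Sum>i<r'. f' i x * g' i y)" for x y
    by (induction r') (simp_all add: add.assoc)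
  then show ?thesis
    unfolding tensor_funs_def using h h'
    by (intro CollectI exI[of _ "r + r'"] exI[of _ ?f] exI[of _ ?g]) (auto simp: fun_eq_iff)
qed

text \<open>
  A product of two sums of simple tensors is a double sum of simple tensors.
\<close>

lemma tensor_funs_mult:
  assumes X: "space_with_functions X" "openin (topol X) U"
    and Y: "space_with_functions Y" "openin (topol Y) V"
    and h: "h \<in> tensor_funs X Y U V" "h' \<in> tensor_funs X Y U V"
  shows "(\<lambda>p. h p * h' p) \<in> tensor_funs X Y U V"
proof -
  have sums: "(\<lambda>p. \<Sum>i<n. t i p) \<in> tensor_funs X Y U V"
    if "\<And>i. i < n \<Longrightarrow> t i \<in> tensor_funs X Y U V" for n :: nat and t
    using that by (induction n) (auto intro: tensor_funs_0 tensor_funs_add)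
  obtain r :: nat and f g where h1: "h = (\<lambda>(x, y). \<Sum>i<r. f i x * g i y)"
    "\<forall>i<r. f i \<in> reg X U" "\<forall>i<r. g i \<in> reg Y V"
    using h(1) unfolding tensor_funs_def by blast
  obtain r' :: nat and f' g' where h2: "h' = (\<lambda>(x, y). \<Sum>i<r'. f' i x * g' i y)"
    "\<forall>i<r'. f' i \<in> reg X U" "\<forall>i<r'. g' i \<in> reg Y V"
    using h(2) unfolding tensor_funs_def by blast
  have "(\<lambda>p. \<Sum>i<r. \<Sum>j<r'. (\<lambda>(x, y). (f i x * f' j x) * (g i y * g' j y)) p) \<in> tensor_funs X Y U V"
    using h1 h2 by (intro sums tensor_funs_simple reg_mult[OF X] reg_mult[OF Y]) auto
  also have "(\<lambda>p. \<Sum>i<r. \<Sum>j<r'. (\<lambda>(x, y). (f i x * f' j x) * (g i y * g' j y)) p) = (\<lambda>p. h p * h' p)"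
    by (auto simp: fun_eq_iff h1 h2 sum_product intro!: sum.cong)
  finally show ?thesis .
qed

lemma tensor_funs_mono:
  assumes X: "space_with_functions X" "openin (topol X) U" "openin (topol X) U'" "U' \<subseteq> U"
    and Y: "space_with_functions Y" "openin (topol Y) V" "openin (topol Y) V'" "V' \<subseteq> V"
  shows "tensor_funs X Y U V \<subseteq> tensor_funs X Y U' V'"
proof -
  have "reg X U \<subseteq> reg X U'" "reg Y V \<subseteq> reg Y V'"
    using reg_subset[OF X] reg_subset[OF Y] by auto
  then show ?thesis unfolding tensor_funs_def by blast
qed

context
  fixes X :: "('p, 'k::field) fspace" and Y :: "('q, 'k) fspace"
  assumes X: "space_with_functions X" and Y: "space_with_functions Y"
begin

lemma fraction_data_prod:
  "fraction_data {(U, V). openin (topol X) U \<and> openin (topol Y) V} (\<lambda>(U, V). U \<times> V)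
     (\<lambda>(U, V). tensor_funs X Y U V)"
proof unfold_locales
  fix i c assume "i \<in> {(U, V). openin (topol X) U \<and> openin (topol Y) V}"
  then obtain U V where i: "i = (U, V)" "openin (topol X) U" "openin (topol Y) V" by auto
  have "(\<lambda>(x, y). c * 1) \<in> tensor_funs X Y U V"
    by (intro tensor_funs_simple reg_const[OF X i(2)] reg_const[OF Y i(3)])
  then show "\<exists>a\<in>case i of (U, V) \<Rightarrow> tensor_funs X Y U V. \<forall>x\<in>case i of (U, V) \<Rightarrow> U \<times> V. a x = c"
    using i(1) by (auto intro!: bexI[of _ "\<lambda>(x, y). c * 1"])
next
  fix i f g assume "i \<in> {(U, V). openin (topol X) U \<and> openin (topol Y) V}"
    and "f \<in> (case i of (U, V) \<Rightarrow> tensor_funs X Y U V)" "g \<in> (case i of (U, V) \<Rightarrow> tensor_funs X Y U V)"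
  then obtain U V where i: "i = (U, V)" "openin (topol X) U" "openin (topol Y) V"
    and fg: "f \<in> tensor_funs X Y U V" "g \<in> tensor_funs X Y U V" by auto
  show "\<exists>a\<in>case i of (U, V) \<Rightarrow> tensor_funs X Y U V. \<forall>x\<in>case i of (U, V) \<Rightarrow> U \<times> V. a x = f x + g x"
    using tensor_funs_add[OF fg] i(1) by (auto intro!: bexI[of _ "\<lambda>x. f x + g x"])
  show "\<exists>a\<in>case i of (U, V) \<Rightarrow> tensor_funs X Y U V. \<forall>x\<in>case i of (U, V) \<Rightarrow> U \<times> V. a x = f x * g x"
    using tensor_funs_mult[OF X i(2) Y i(3) fg] i(1) by (auto intro!: bexI[of _ "\<lambda>x. f x * g x"])
next
  fix i j assume "i \<in> {(U, V). openin (topol X) U \<and> openin (topol Y) V}"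
    "j \<in> {(U, V). openin (topol X) U \<and> openin (topol Y) V}"
  then obtain U V U' V' where i: "i = (U, V)" "openin (topol X) U" "openin (topol Y) V"
    and j: "j = (U', V')" "openin (topol X) U'" "openin (topol Y) V'" by auto
  have o: "openin (topol X) (U \<inter> U')" "openin (topol Y) (V \<inter> V')" using i j by auto
  have "tensor_funs X Y U V \<subseteq> tensor_funs X Y (U \<inter> U') (V \<inter> V')"
    "tensor_funs X Y U' V' \<subseteq> tensor_funs X Y (U \<inter> U') (V \<inter> V')"
    using i j o by (intro tensor_funs_mono[OF X _ _ _ Y]; simp)+
  then show "\<exists>k\<in>{(U, V). openin (topol X) U \<and> openin (topol Y) V}.
      (case k of (U, V) \<Rightarrow> U \<times> V) = (case i of (U, V) \<Rightarrow> U \<times> V) \<inter> (case j of (U, V) \<Rightarrow> U \<times> V) \<and>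
      (\<forall>a\<in>(case i of (U, V) \<Rightarrow> tensor_funs X Y U V) \<union> (case j of (U, V) \<Rightarrow> tensor_funs X Y U V).
          \<exists>b\<in>case k of (U, V) \<Rightarrow> tensor_funs X Y U V. \<forall>x\<in>case k of (U, V) \<Rightarrow> U \<times> V. b x = a x)"
    using i(1) j(1) o by (intro bexI[of _ "(U \<inter> U', V \<inter> V')"]) auto
qed

interpretation P: fraction_data "{(U, V). openin (topol X) U \<and> openin (topol Y) V}"
  "\<lambda>(U, V). U \<times> V" "\<lambda>(U, V). tensor_funs X Y U V"
  by (rule fraction_data_prod)

lemma prod_space_fraction_space: "prod_space X Y = P.Y"
proof -
  have "{{p \<in> U \<times> V. h p \<noteq> 0} | U V h.
           openin (topol X) U \<and> openin (topol Y) V \<and> h \<in> tensor_funs X Y U V} =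
    {{x\<in>(case i of (U, V) \<Rightarrow> U \<times> V). h x \<noteq> 0} | i h.
       i \<in> {(U, V). openin (topol X) U \<and> openin (topol Y) V} \<and>
       h \<in> (case i of (U, V) \<Rightarrow> tensor_funs X Y U V)}" by auto
  then show ?thesis
    unfolding prod_space_def fraction_space_def by (auto simp: fun_eq_iff)
qed

lemma space_with_functions_prod: "space_with_functions (prod_space X Y)"
  unfolding prod_space_fraction_space by (rule P.space_with_functions)

lemma points_prod_space: "points (prod_space X Y) = points X \<times> points Y"
  unfolding prod_space_fraction_space P.points_fraction_space
  unfolding points_def by (auto dest: openin_subset)

text \<open>
  The universal property of the product. A function \<open>\<Sum>i. f\<^sub>i(x) g\<^sub>i(y)\<close> pulls back to a sum of
  products of pullbacks of regular functions.
\<close>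

lemma morphism_into_prod:
  assumes Z: "space_with_functions Z" and \<phi>: "morphism Z X \<phi>" and \<psi>: "morphism Z Y \<psi>"
  shows "morphism Z (prod_space X Y) (\<lambda>z. (\<phi> z, \<psi> z))"
  unfolding prod_space_fraction_space
proof (rule P.morphism_into[OF Z])
  show "(\<phi> z, \<psi> z) \<in> (\<Union>i\<in>{(U, V). openin (topol X) U \<and> openin (topol Y) V}. case i of (U, V) \<Rightarrow> U \<times> V)"
    if "z \<in> points Z" for z
    using morphism_points[OF \<phi> that] morphism_points[OF \<psi> that] unfolding points_def
    by (intro UN_I[of "(topspace (topol X), topspace (topol Y))"]) simp_all
  fix i assume "i \<in> {(U, V). openin (topol X) U \<and> openin (topol Y) V}"
  then obtain U V where i: "i = (U, V)" "openin (topol X) U" "openin (topol Y) V" by auto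
  let ?U = "{z\<in>points Z. \<phi> z \<in> U}" and ?V = "{z\<in>points Z. \<psi> z \<in> V}"
  have o: "openin (topol Z) ?U" "openin (topol Z) ?V"
    by (rule openin_preimage_morphism[OF \<phi> i(2)] openin_preimage_morphism[OF \<psi> i(3)])+
  then have oUV: "openin (topol Z) (?U \<inter> ?V)" by (rule openin_Int)
  have eq: "{z \<in> points Z. (\<phi> z, \<psi> z) \<in> (case i of (U, V) \<Rightarrow> U \<times> V)} = ?U \<inter> ?V"
    unfolding i by auto
  show "openin (topol Z) {z \<in> points Z. (\<phi> z, \<psi> z) \<in> (case i of (U, V) \<Rightarrow> U \<times> V)}"
    unfolding eq by (rule oUV)
  fix a assume "a \<in> (case i of (U, V) \<Rightarrow> tensor_funs X Y U V)"
  then obtain r :: nat and f g where a: "a = (\<lambda>(x, y). \<Sum>i<r. f i x * g i y)"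
    "\<forall>i<r::nat. f i \<in> reg X U" "\<forall>i<r. g i \<in> reg Y V"
    unfolding i tensor_funs_def by auto
  have fg: "(\<lambda>z. f i (\<phi> z) * g i (\<psi> z)) \<in> reg Z (?U \<inter> ?V)" if "i < r" for i
  proof (rule reg_mult[OF Z oUV])
    show "(\<lambda>z. f i (\<phi> z)) \<in> reg Z (?U \<inter> ?V)"
      using a(2) that by (intro reg_subset[OF Z o(1) oUV] reg_pullback[OF \<phi> i(2)]) auto
    show "(\<lambda>z. g i (\<psi> z)) \<in> reg Z (?U \<inter> ?V)"
      using a(3) that by (intro reg_subset[OF Z o(2) oUV] reg_pullback[OF \<psi> i(3)]) auto
  qed
  have "(\<lambda>z. \<Sum>i<n. f i (\<phi> z) * g i (\<psi> z)) \<in> reg Z (?U \<inter> ?V)" if "n \<le> r" for n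
    using that
  proof (induction n)
    case 0 show ?case using reg_const[OF Z oUV, of 0] by simp
  next
    case (Suc n) then show ?case using reg_add[OF Z oUV _ fg[of n]] by simp
  qed
  then show "(\<lambda>z. a (\<phi> z, \<psi> z)) \<in> reg Z {z \<in> points Z. (\<phi> z, \<psi> z) \<in> (case i of (U, V) \<Rightarrow> U \<times> V)}"
    unfolding eq a by simp
qed

end

lemma tensor_funs_le_reg:
  assumes X: "space_with_functions X" and Y: "space_with_functions Y"
    and U: "openin (topol X) U" and V: "openin (topol Y) V"
    and h: "h \<in> tensor_funs X Y U V"
  shows "h \<in> reg (prod_space X Y) (U \<times> V)"
proof -
  have "(\<lambda>(x, y). 1 * 1) \<in> tensor_funs X Y U V"
    by (intro tensor_funs_simple reg_const[OF X U] reg_const[OF Y V])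
  then have "(\<lambda>_. 1) \<in> tensor_funs X Y U V" by (simp add: case_prod_unfold)
  then have *: "\<exists>U' V'. openin (topol X) U' \<and> openin (topol Y) V' \<and> p \<in> U' \<times> V' \<and>
      (\<exists>a\<in>tensor_funs X Y U' V'. \<exists>b\<in>tensor_funs X Y U' V'. b p \<noteq> 0 \<and>
        (\<forall>q\<in>U \<times> V \<inter> U' \<times> V'. b q \<noteq> 0 \<longrightarrow> h q = a q / b q))" if "p \<in> U \<times> V" for p
    using U V h that
    by (intro exI[of _ U] exI[of _ V] conjI bexI[of _ h] bexI[of _ "\<lambda>_. 1"]) simp_all
  show ?thesis
    unfolding prod_space_def fspace.select_convs mem_Collect_eq by (intro ballI) (rule *)
qed

lemma openin_prod_space_Times:
  assumes X: "space_with_functions X" and Y: "space_with_functions Y"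
    and U: "openin (topol X) U" and V: "openin (topol Y) V"
  shows "openin (topol (prod_space X Y)) (U \<times> V)"
  using fraction_data.openin_D[OF fraction_data_prod[OF X Y], of "(U, V)"] U V
  by (simp add: prod_space_fraction_space[OF X Y])

lemma morphism_fst:
  assumes X: "space_with_functions X" and Y: "space_with_functions Y"
  shows "morphism (prod_space X Y) X fst"
proof (rule morphismI)
  show "fst p \<in> points X" if "p \<in> points (prod_space X Y)" for p
    using that by (auto simp: points_prod_space[OF X Y])
  fix U assume U: "openin (topol X) U"
  have eq: "{p \<in> points (prod_space X Y). fst p \<in> U} = U \<times> points Y"
    using openin_subset_points[OF U] by (auto simp: points_prod_space[OF X Y])
  show "openin (topol (prod_space X Y)) {p \<in> points (prod_space X Y). fst p \<in> U}"
    unfolding eq by (rule openin_prod_space_Times[OF X Y U openin_points])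
  show "(\<lambda>p. f (fst p)) \<in> reg (prod_space X Y) {p \<in> points (prod_space X Y). fst p \<in> U}"
    if "f \<in> reg X U" for f
    using tensor_funs_le_reg[OF X Y U openin_points
        tensor_funs_simple[OF that reg_const[OF Y openin_points, of 1]]]
    unfolding eq by (simp add: case_prod_unfold)
qed

lemma morphism_snd:
  assumes X: "space_with_functions X" and Y: "space_with_functions Y"
  shows "morphism (prod_space X Y) Y snd"
proof (rule morphismI)
  show "snd p \<in> points Y" if "p \<in> points (prod_space X Y)" for p
    using that by (auto simp: points_prod_space[OF X Y])
  fix V assume V: "openin (topol Y) V"
  have eq: "{p \<in> points (prod_space X Y). snd p \<in> V} = points X \<times> V"
    using openin_subset_points[OF V] by (auto simp: points_prod_space[OF X Y])
  show "openin (topol (prod_space X Y)) {p \<in> points (prod_space X Y). snd p \<in> V}"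
    unfolding eq by (rule openin_prod_space_Times[OF X Y openin_points V])
  show "(\<lambda>p. f (snd p)) \<in> reg (prod_space X Y) {p \<in> points (prod_space X Y). snd p \<in> V}"
    if "f \<in> reg Y V" for f
    using tensor_funs_le_reg[OF X Y openin_points V
        tensor_funs_simple[OF reg_const[OF X openin_points, of 1] that]]
    unfolding eq by (simp add: case_prod_unfold)
qed

section \<open>Induced structures and affine spaces\<close>

lemma reg_induced_iff:
  "f \<in> reg (induced X Z) W \<longleftrightarrow>
     (\<forall>x\<in>W. \<exists>U g. openin (topol X) U \<and> x \<in> U \<and> g \<in> reg X U \<and> (\<forall>y\<in>W \<inter> U. f y = g y))"
  by (simp add: induced_def)

lemma reg_inducedE:
  assumes "f \<in> reg (induced X Z) W" "x \<in> W"
  obtains U g where "openin (topol X) U" "x \<in> U" "g \<in> reg X U" "\<forall>y\<in>W \<inter> U. f y = g y"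
  using bspec[OF iffD1[OF reg_induced_iff assms(1)] assms(2)] by (elim exE conjE)

lemma space_with_functions_induced:
  assumes X: "space_with_functions X"
  shows "space_with_functions (induced X Z)"
  unfolding space_with_functions_def
proof (intro conjI allI impI ballI)
  have op: "openin (topol (induced X Z)) W \<longleftrightarrow> (\<exists>U. openin (topol X) U \<and> W = U \<inter> Z)" for W
    by (auto simp: induced_def openin_subtopology)
  fix W c assume "openin (topol (induced X Z)) W"
  then show "(\<lambda>_. c) \<in> reg (induced X Z) W"
    using reg_const[OF X openin_topspace, of c] openin_subset
    by (fastforce simp: op reg_induced_iff intro: exI[of _ "topspace (topol X)"])
next
  fix W f g assume fg: "f \<in> reg (induced X Z) W" "g \<in> reg (induced X Z) W"
  have common: "\<exists>U f' g'. openin (topol X) U \<and> x \<in> U \<and> f' \<in> reg X U \<and> g' \<in> reg X U \<and>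
      (\<forall>y\<in>W \<inter> U. f y = f' y \<and> g y = g' y)" if x: "x \<in> W" for x
  proof -
    obtain U f' where f: "openin (topol X) U" "x \<in> U" "f' \<in> reg X U" "\<forall>y\<in>W \<inter> U. f y = f' y"
      using reg_inducedE[OF fg(1) x] .
    obtain V g' where g: "openin (topol X) V" "x \<in> V" "g' \<in> reg X V" "\<forall>y\<in>W \<inter> V. g y = g' y"
      using reg_inducedE[OF fg(2) x] .
    have "openin (topol X) (U \<inter> V)" using f g by auto
    then show ?thesis using f g
      by (intro exI[of _ "U \<inter> V"] exI[of _ f'] exI[of _ g'])
        (auto intro: reg_subset[OF X f(1)] reg_subset[OF X g(1)])
  qed
  show "(\<lambda>x. f x + g x) \<in> reg (induced X Z) W"
    unfolding reg_induced_iff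
  proof
    fix x assume "x \<in> W"
    from common[OF this] obtain U f' g' where "openin (topol X) U" "x \<in> U" "f' \<in> reg X U"
      "g' \<in> reg X U" "\<forall>y\<in>W \<inter> U. f y = f' y \<and> g y = g' y" by (elim exE conjE)
    then show "\<exists>U h. openin (topol X) U \<and> x \<in> U \<and> h \<in> reg X U \<and> (\<forall>y\<in>W \<inter> U. f y + g y = h y)"
      by (intro exI[of _ U] exI[of _ "\<lambda>y. f' y + g' y"]) (simp add: reg_add[OF X])
  qed
  show "(\<lambda>x. f x * g x) \<in> reg (induced X Z) W"
    unfolding reg_induced_iff
  proof
    fix x assume "x \<in> W"
    from common[OF this] obtain U f' g' where "openin (topol X) U" "x \<in> U" "f' \<in> reg X U"
      "g' \<in> reg X U" "\<forall>y\<in>W \<inter> U. f y = f' y \<and> g y = g' y" by (elim exE conjE)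
    then show "\<exists>U h. openin (topol X) U \<and> x \<in> U \<and> h \<in> reg X U \<and> (\<forall>y\<in>W \<inter> U. f y * g y = h y)"
      by (intro exI[of _ U] exI[of _ "\<lambda>y. f' y * g' y"]) (simp add: reg_mult[OF X])
  qed
next
  fix W f g assume "f \<in> reg (induced X Z) W" "\<forall>x\<in>W. g x = f x"
  then show "g \<in> reg (induced X Z) W" by (simp add: reg_induced_iff)
next
  fix W f assume W: "openin (topol (induced X Z)) W" and f: "f \<in> reg (induced X Z) W"
  obtain O' where O': "openin (topol X) O'" "W = O' \<inter> Z"
    using W by (auto simp: induced_def openin_subtopology)
  show "openin (topol (induced X Z)) {x \<in> W. f x \<noteq> 0}"
  proof (subst openin_subopen, intro ballI)
    fix x assume x: "x \<in> {x \<in> W. f x \<noteq> 0}"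
    then have "x \<in> W" by simp
    from reg_inducedE[OF f this] obtain U g
      where g: "openin (topol X) U" "x \<in> U" "g \<in> reg X U" "\<forall>y\<in>W \<inter> U. f y = g y" .
    have "openin (topol X) ({y\<in>U. g y \<noteq> 0} \<inter> O')" using O' open_nonvanishing[OF X g(1,3)] by auto
    then have "openin (topol (induced X Z)) (({y\<in>U. g y \<noteq> 0} \<inter> O') \<inter> Z)"
      by (auto simp: induced_def openin_subtopology)
    then show "\<exists>T. openin (topol (induced X Z)) T \<and> x \<in> T \<and> T \<subseteq> {x \<in> W. f x \<noteq> 0}"
      using x g O' by (intro exI[of _ "({y\<in>U. g y \<noteq> 0} \<inter> O') \<inter> Z"]) auto
  qed
  show "(\<lambda>x. inverse (f x)) \<in> reg (induced X Z) {x \<in> W. f x \<noteq> 0}"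
    unfolding reg_induced_iff
  proof
    fix x assume x: "x \<in> {x \<in> W. f x \<noteq> 0}"
    then have "x \<in> W" by simp
    from reg_inducedE[OF f this] obtain U g
      where g: "openin (topol X) U" "x \<in> U" "g \<in> reg X U" "\<forall>y\<in>W \<inter> U. f y = g y" .
    then show "\<exists>U g. openin (topol X) U \<and> x \<in> U \<and> g \<in> reg X U \<and>
        (\<forall>y\<in>{x \<in> W. f x \<noteq> 0} \<inter> U. inverse (f y) = g y)"
      using x open_nonvanishing[OF X g(1,3)] reg_inverse[OF X g(1,3)]
      by (intro exI[of _ "{y\<in>U. g y \<noteq> 0}"] exI[of _ "\<lambda>y. inverse (g y)"]) auto
  qed
next
  fix \<U> f assume \<U>: "\<forall>U\<in>\<U>. openin (topol (induced X Z)) U"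
  show "f \<in> reg (induced X Z) (\<Union>\<U>) \<longleftrightarrow> (\<forall>U\<in>\<U>. f \<in> reg (induced X Z) U)"
  proof
    assume f: "f \<in> reg (induced X Z) (\<Union>\<U>)"
    show "\<forall>U\<in>\<U>. f \<in> reg (induced X Z) U"
      unfolding reg_induced_iff
    proof (intro ballI)
      fix W x assume W: "W \<in> \<U>" "x \<in> W"
      then have "x \<in> \<Union>\<U>" by blast
      from reg_inducedE[OF f this] obtain U g
        where "openin (topol X) U" "x \<in> U" "g \<in> reg X U" "\<forall>y\<in>\<Union>\<U> \<inter> U. f y = g y" .
      with W show "\<exists>U g. openin (topol X) U \<and> x \<in> U \<and> g \<in> reg X U \<and> (\<forall>y\<in>W \<inter> U. f y = g y)"
        by (intro exI[of _ U] exI[of _ g]) auto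
    qed
  next
    assume R: "\<forall>U\<in>\<U>. f \<in> reg (induced X Z) U"
    show "f \<in> reg (induced X Z) (\<Union>\<U>)"
      unfolding reg_induced_iff
    proof
      fix x assume "x \<in> \<Union>\<U>"
      then obtain W where W: "W \<in> \<U>" "x \<in> W" by blast
      obtain U g where g: "openin (topol X) U" "x \<in> U" "g \<in> reg X U" "\<forall>y\<in>W \<inter> U. f y = g y"
        using reg_inducedE[OF bspec[OF R W(1)] W(2)] .
      obtain O' where O': "openin (topol X) O'" "W = O' \<inter> Z"
        using W \<U> by (auto simp: induced_def openin_subtopology)
      have Z: "\<Union>\<U> \<subseteq> Z" using \<U> by (auto simp: induced_def openin_subtopology)
      have o: "openin (topol X) (U \<inter> O')" using g O' by auto
      show "\<exists>U g. openin (topol X) U \<and> x \<in> U \<and> g \<in> reg X U \<and> (\<forall>y\<in>\<Union>\<U> \<inter> U. f y = g y)"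
        using o g O' W Z reg_subset[OF X g(1) o _ g(3)]
        by (intro exI[of _ "U \<inter> O'"] exI[of _ g]) auto
    qed
  qed
qed

lemma points_induced: "points (induced X Z) = points X \<inter> Z"
  by (simp add: points_def induced_def)

lemma morphism_inclusion: "morphism (induced X Z) X (\<lambda>x. x)"
proof (rule morphismI)
  show "x \<in> points X" if "x \<in> points (induced X Z)" for x using that by (simp add: points_induced)
  fix V assume V: "openin (topol X) V"
  have "{x\<in>points (induced X Z). x \<in> V} = V \<inter> Z"
    using openin_subset_points[OF V] by (auto simp: points_induced)
  then show "openin (topol (induced X Z)) {x\<in>points (induced X Z). x \<in> V}"
    using V by (auto simp: induced_def openin_subtopology)
  show "f \<in> reg (induced X Z) {x\<in>points (induced X Z). x \<in> V}" if "f \<in> reg X V" for f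
    unfolding reg_induced_iff using V that by (intro ballI exI[of _ V] exI[of _ f]) auto
qed

text \<open>
  On an open subset the induced structure is the restriction of the given one.
\<close>

lemma reg_induced_open:
  assumes X: "space_with_functions X" and V: "openin (topol X) V" and f: "f \<in> reg (induced X V) V"
  shows "f \<in> reg X V"
proof (rule reg_local[OF X])
  fix x assume x: "x \<in> V"
  from reg_inducedE[OF f this] obtain U g
    where g: "openin (topol X) U" "x \<in> U" "g \<in> reg X U" "\<forall>y\<in>V \<inter> U. f y = g y" .
  have o: "openin (topol X) (U \<inter> V)" using g V by auto
  have "f \<in> reg X (U \<inter> V)"
    by (rule reg_cong[OF X o reg_subset[OF X g(1) o Int_lower1 g(3)]]) (use g in auto)
  then show "\<exists>W. openin (topol X) W \<and> x \<in> W \<and> W \<subseteq> V \<and> f \<in> reg X W" using o x g by blast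
qed

text \<open>
  Evaluation at \<open>y\<close> is an algebra homomorphism, and an affine space has only one point that induces
  it.
\<close>

lemma affine_space_separates:
  assumes X: "space_with_functions X" and V: "openin (topol X) V" "affine_space (induced X V)"
    and xy: "x \<in> V" "y \<in> V" and eq: "\<And>f. f \<in> reg X V \<Longrightarrow> f x = f y"
  shows "x = y"
proof -
  have pV: "points (induced X V) = V"
    using openin_subset_points[OF V(1)] by (auto simp: points_induced)
  have "alg_hom_on V (reg (induced X V) V) (\<lambda>f. f y)"
    unfolding alg_hom_on_def using xy by auto
  moreover have "\<forall>\<phi>. alg_hom_on V (reg (induced X V) V) \<phi> \<longrightarrow>
      (\<exists>!x. x \<in> V \<and> (\<forall>f\<in>reg (induced X V) V. \<phi> f = f x))"
    using V(2) unfolding affine_space_def Let_def pV by simp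
  ultimately have "\<exists>!x. x \<in> V \<and> (\<forall>f\<in>reg (induced X V) V. f y = f x)" by simp
  moreover have "\<forall>f\<in>reg (induced X V) V. f y = f x"
    by (intro ballI eq[symmetric] reg_induced_open[OF X V(1)])
  ultimately show ?thesis using xy by blast
qed

section \<open>The torus and its characters\<close>

lemma carrier_torus: "t \<in> carrier torus \<longleftrightarrow> (\<forall>i. t $ i \<noteq> 0)"
  by (simp add: torus_def)

lemma group_mult_group: "group (mult_group :: 'k::field monoid)"
proof (rule groupI)
  show "\<exists>y\<in>carrier mult_group. y \<otimes>\<^bsub>mult_group\<^esub> x = \<one>\<^bsub>mult_group\<^esub>"
    if "x \<in> carrier mult_group" for x :: 'k
    using that by (intro bexI[of _ "inverse x"]) (auto simp: mult_group_def)
qed (auto simp: mult_group_def)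

lemma character_0 [simp]: "character 0 t = 1"
  by (simp add: character_def)

lemma character_add:
  assumes "t \<in> carrier torus"
  shows "character (m + m') t = character m t * character m' t"
  using assms by (simp add: character_def carrier_torus power_int_add prod.distrib)

lemma character_mult: "character m (t \<otimes>\<^bsub>torus\<^esub> u) = character m t * character m u"
  by (simp add: character_def torus_def power_int_mult_distrib prod.distrib)

lemma character_nonzero: "t \<in> carrier torus \<Longrightarrow> character m t \<noteq> 0"
  by (simp add: character_def carrier_torus)

lemma character_uminus:
  assumes "t \<in> carrier torus"
  shows "character (- m) t = inverse (character m t)"
proof -
  have "character m t * character (- m) t = 1" using character_add[OF assms, of m "- m"] by simp
  from inverse_unique[OF this] show ?thesis by simp
qed

lemma character_axis: "character (axis i 1) t = t $ i"
proof -
  have "character (axis i 1) t = (\<Prod>j\<in>UNIV. if j = i then t $ i else 1)"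
    unfolding character_def by (intro prod.cong) (auto simp: axis_def)
  then show ?thesis by simp
qed

lemma laurent_eval_superset:
  assumes "finite S" "Poly_Mapping.keys p \<subseteq> S"
  shows "laurent_eval p t = (\<Sum>m\<in>S. Poly_Mapping.lookup p m * character m t)"
  unfolding laurent_eval_def using assms
  by (intro sum.mono_neutral_left) (auto simp: in_keys_iff)

lemma laurent_eval_add: "laurent_eval (p + q) t = laurent_eval p t + laurent_eval q t"
proof -
  let ?S = "Poly_Mapping.keys p \<union> Poly_Mapping.keys q"
  have "Poly_Mapping.keys (p + q) \<subseteq> ?S" by (rule Poly_Mapping.keys_add)
  then have "laurent_eval r t = (\<Sum>m\<in>?S. Poly_Mapping.lookup r m * character m t)"
    if "r \<in> {p, q, p + q}" for r
    using that by (intro laurent_eval_superset) auto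
  then show ?thesis by (simp add: lookup_add distrib_right sum.distrib)
qed

lemma laurent_eval_single: "laurent_eval (Poly_Mapping.single m a) t = a * character m t"
  by (simp add: laurent_eval_def)

lemma laurent_eval_0: "laurent_eval 0 t = 0"
  by (simp add: laurent_eval_def)

lemma laurent_eval_sum: "laurent_eval (sum f S) t = (\<Sum>i\<in>S. laurent_eval (f i) t)"
  by (induction S rule: infinite_finite_induct) (simp_all add: laurent_eval_add laurent_eval_0)

lemma poly_mapping_sum_single:
  "p = (\<Sum>m\<in>Poly_Mapping.keys p. Poly_Mapping.single m (Poly_Mapping.lookup p m))"
proof (rule poly_mapping_eqI)
  fix k
  have "Poly_Mapping.lookup (\<Sum>m\<in>Poly_Mapping.keys p. Poly_Mapping.single m (Poly_Mapping.lookup p m)) k =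
      (\<Sum>m\<in>Poly_Mapping.keys p. if m = k then Poly_Mapping.lookup p k else 0)"
    unfolding lookup_sum by (intro sum.cong) (auto simp: lookup_single when_def)
  then show "Poly_Mapping.lookup p k =
      Poly_Mapping.lookup (\<Sum>m\<in>Poly_Mapping.keys p. Poly_Mapping.single m (Poly_Mapping.lookup p m)) k"
    by (simp add: in_keys_iff)
qed

text \<open>
  Multiplicativity reduces to monomials by writing both factors as sums of monomials.
\<close>

lemma laurent_eval_mult:
  assumes t: "t \<in> carrier torus"
  shows "laurent_eval (p * q) t = laurent_eval p t * laurent_eval q t"
proof -
  let ?s = "\<lambda>r m. Poly_Mapping.single m (Poly_Mapping.lookup r m)"
  have "p * q = (\<Sum>m\<in>Poly_Mapping.keys p. ?s p m) * (\<Sum>n\<in>Poly_Mapping.keys q. ?s q n)"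
    using poly_mapping_sum_single[of p] poly_mapping_sum_single[of q] by simp
  also have "\<dots> = (\<Sum>m\<in>Poly_Mapping.keys p. \<Sum>n\<in>Poly_Mapping.keys q. ?s p m * ?s q n)"
    by (rule sum_product)
  also have "laurent_eval \<dots> t = (\<Sum>m\<in>Poly_Mapping.keys p. \<Sum>n\<in>Poly_Mapping.keys q.
      (Poly_Mapping.lookup p m * character m t) * (Poly_Mapping.lookup q n * character n t))"
    by (simp add: laurent_eval_sum mult_single laurent_eval_single character_add[OF t] algebra_simps)
  also have "\<dots> = laurent_eval p t * laurent_eval q t"
    unfolding laurent_eval_def by (rule sum_product[symmetric])
  finally show ?thesis .
qed

lemma
  shows space_with_functions_torus: "space_with_functions (torus_space :: ('k::field ^ 'n, 'k) fspace)"
    and points_torus_space: "points (torus_space :: ('k ^ 'n, 'k) fspace) = carrier torus"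
proof -
  have c: "\<exists>a\<in>range laurent_eval. \<forall>t\<in>carrier torus. a t = c" for c :: 'k
    by (intro bexI[of _ "laurent_eval (Poly_Mapping.single 0 c)"]) (auto simp: laurent_eval_single)
  have a: "\<exists>a\<in>range laurent_eval. \<forall>t\<in>carrier torus. a t = f t + g t"
    if "f \<in> range laurent_eval" "g \<in> range laurent_eval" for f g :: "'k ^ 'n \<Rightarrow> 'k"
  proof -
    from that obtain p q where "f = laurent_eval p" "g = laurent_eval q" by blast
    then show ?thesis by (intro bexI[of _ "laurent_eval (p + q)"]) (auto simp: laurent_eval_add)
  qed
  have m: "\<exists>a\<in>range laurent_eval. \<forall>t\<in>carrier torus. a t = f t * g t"
    if "f \<in> range laurent_eval" "g \<in> range laurent_eval" for f g :: "'k ^ 'n \<Rightarrow> 'k"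
  proof -
    from that obtain p q where "f = laurent_eval p" "g = laurent_eval q" by blast
    then show ?thesis by (intro bexI[of _ "laurent_eval (p * q)"]) (auto simp: laurent_eval_mult)
  qed
  show "space_with_functions (torus_space :: ('k ^ 'n, 'k) fspace)"
    unfolding torus_space_def by (rule space_with_functions_alg_space[OF c a m])
  show "points (torus_space :: ('k ^ 'n, 'k) fspace) = carrier torus"
    unfolding torus_space_def by (rule points_alg_space[OF c a m])
qed

lemma
  shows space_with_functions_add_group: "space_with_functions (add_group_space :: ('k::field, 'k) fspace)"
    and points_add_group_space: "points (add_group_space :: ('k, 'k) fspace) = UNIV"
proof -
  have c: "\<exists>a\<in>range poly. \<forall>x\<in>UNIV. a x = c" for c :: 'k
    by (intro bexI[of _ "poly [:c:]"]) auto
  have a: "\<exists>a\<in>range poly. \<forall>x\<in>UNIV. a x = f x + g x"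
    if "f \<in> range poly" "g \<in> range poly" for f g :: "'k \<Rightarrow> 'k"
  proof -
    from that obtain p q where "f = poly p" "g = poly q" by blast
    then show ?thesis by (intro bexI[of _ "poly (p + q)"]) auto
  qed
  have m: "\<exists>a\<in>range poly. \<forall>x\<in>UNIV. a x = f x * g x"
    if "f \<in> range poly" "g \<in> range poly" for f g :: "'k \<Rightarrow> 'k"
  proof -
    from that obtain p q where "f = poly p" "g = poly q" by blast
    then show ?thesis by (intro bexI[of _ "poly (p * q)"]) auto
  qed
  show "space_with_functions (add_group_space :: ('k, 'k) fspace)"
    unfolding add_group_space_def by (rule space_with_functions_alg_space[OF c a m])
  show "points (add_group_space :: ('k, 'k) fspace) = UNIV"
    unfolding add_group_space_def by (rule points_alg_space[OF c a m])
qed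

lemma carrier_ker_group: "carrier (ker_group e) = {t \<in> carrier torus. character e t = 1}"
  by (auto simp: ker_group_def kernel_def mult_group_def)

lemma space_with_functions_ker: "space_with_functions (ker_space e)"
  unfolding ker_space_def by (rule space_with_functions_induced[OF space_with_functions_torus])

lemma points_ker_space: "points (ker_space e) = carrier (ker_group e)"
  unfolding ker_space_def points_induced points_torus_space ker_group_def
  by (auto simp: kernel_def)

lemma morphism_ker_torus: "morphism (ker_space e) torus_space (\<lambda>t. t)"
  unfolding ker_space_def by (rule morphism_inclusion)

lemma group_ker_group:
  assumes "group (torus :: ('k::field ^ 'n) monoid)"
  shows "group (ker_group e :: ('k ^ 'n) monoid)"
proof -
  have "group_hom (torus :: ('k ^ 'n) monoid) mult_group (character e)"
    by (rule group_hom.intro[OF assms group_mult_group])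
      (auto simp: group_hom_axioms_def hom_def mult_group_def character_mult character_nonzero)
  then have "subgroup (kernel torus mult_group (character e)) (torus :: ('k ^ 'n) monoid)"
    by (rule group_hom.subgroup_kernel)
  from subgroup.subgroup_is_group[OF this assms] show ?thesis
    unfolding ker_group_def .
qed

section \<open>Primitive vectors and roots\<close>

lemma pairing_uminus_right: "pairing v (- m) = - pairing v m"
  by (simp add: pairing_def sum_negf)

lemma pairing_add_right: "pairing v (m + m') = pairing v m + pairing v m'"
  by (simp add: pairing_def distrib_left sum.distrib)

lemma pairing_scale_right: "pairing v (k *s m) = of_int k * pairing v m"
  by (simp add: pairing_def sum_distrib_left mult.left_commute)

lemma pairing_0_right: "pairing v 0 = 0"
  by (simp add: pairing_def)

lemma pairing_axis: "pairing v (axis i 1) = v $ i"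
proof -
  have "pairing v (axis i 1) = (\<Sum>j\<in>UNIV. if j = i then v $ i else 0)"
    unfolding pairing_def by (intro sum.cong) (auto simp: axis_def)
  then show ?thesis by simp
qed

lemma pairing_scaled_to_rat: "pairing (q *s to_rat v) m = q * of_int (pairing v m)"
  by (simp add: pairing_def to_rat_def sum_distrib_left mult.assoc)

lemma cone_gen_singleton: "cone_gen {v} = {q *s v | q. 0 \<le> q}"
proof (intro equalityI subsetI)
  fix w assume "w \<in> cone_gen {v}"
  then obtain F c where w: "w = (\<Sum>v\<in>F. c v *s v)" "F \<subseteq> {v}" "\<forall>v\<in>F. 0 \<le> c v"
    unfolding cone_gen_def by auto
  from w(2) have "F = {} \<or> F = {v}" by auto
  then show "w \<in> {q *s v | q. 0 \<le> q}"
  proof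
    assume "F = {}" then show ?thesis using w by (auto intro!: exI[of _ 0])
  next
    assume "F = {v}" then show ?thesis using w by auto
  qed
next
  fix w assume "w \<in> {q *s v | q. 0 \<le> q}"
  then obtain q where "w = q *s v" "0 \<le> q" by auto
  then show "w \<in> cone_gen {v}"
    unfolding cone_gen_def by (intro CollectI exI[of _ "{v}"] exI[of _ "\<lambda>_. q"]) auto
qed

text \<open>
  Clearing denominators by their product.
\<close>

lemma common_multiple_integral:
  fixes v :: "rat ^ 'n"
  obtains d :: int and w :: "int ^ 'n" where "d > 0" "to_rat w = of_int d *s v"
proof -
  define d where "d = (\<Prod>i\<in>UNIV. snd (quotient_of (v $ i)))"
  have pos: "snd (quotient_of (v $ i)) > 0" for i by (rule quotient_of_denom_pos')
  have "d > 0" unfolding d_def by (intro prod_pos) (use pos in auto)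
  have "\<exists>k. of_int k = of_int d * v $ i" for i
  proof -
    have "d = snd (quotient_of (v $ i)) * (\<Prod>j\<in>UNIV - {i}. snd (quotient_of (v $ j)))"
      unfolding d_def by (rule prod.remove) auto
    moreover have "v $ i = of_int (fst (quotient_of (v $ i))) / of_int (snd (quotient_of (v $ i)))"
      by (rule quotient_of_div) simp
    moreover have "of_int (snd (quotient_of (v $ i))) \<noteq> (0::rat)" using pos[of i] by simp
    ultimately have "of_int d * v $ i =
        of_int (fst (quotient_of (v $ i)) * (\<Prod>j\<in>UNIV - {i}. snd (quotient_of (v $ j))))"
      by (simp add: field_simps)
    then show ?thesis by metis
  qed
  then obtain k where "\<And>i. of_int (k i) = of_int d * v $ i" by metis
  then have "to_rat (\<chi> i. k i) = of_int d *s v" by (simp add: to_rat_def vec_eq_iff)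
  with \<open>d > 0\<close> show thesis by (rule that)
qed

text \<open>
  If \<open>w = (a / b) u\<close> in lowest terms with \<open>b > 0\<close>, then comparing the greatest common divisors of
  the entries of \<open>b w = a u\<close> gives \<open>a = b\<close>.
\<close>

lemma primitive_multiple_unique:
  fixes u w :: "int ^ 'n"
  assumes u: "Gcd (range (\<lambda>i. u $ i)) = 1" and w: "Gcd (range (\<lambda>i. w $ i)) = 1"
    and q: "0 \<le> q" "to_rat w = q *s to_rat u"
  shows "w = u"
proof -
  obtain a b where ab: "quotient_of q = (a, b)" by fastforce
  have b: "b > 0" by (rule quotient_of_denom_pos[OF ab])
  have qab: "q = of_int a / of_int b" by (rule quotient_of_div[OF ab])
  have a: "a \<ge> 0" using q(1) b unfolding qab by (simp add: zero_le_divide_iff)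
  have "b * w $ i = a * u $ i" for i
  proof -
    have "of_int (w $ i) = q * of_int (u $ i)" using q(2) by (simp add: to_rat_def vec_eq_iff)
    then have "(of_int (b * w $ i) :: rat) = of_int (a * u $ i)" using b by (simp add: qab field_simps)
    then show ?thesis by (simp only: of_int_eq_iff)
  qed
  then have "(*) b ` range (\<lambda>i. w $ i) = (*) a ` range (\<lambda>i. u $ i)"
    by (simp add: image_image)
  then have "Gcd ((*) b ` range (\<lambda>i. w $ i)) = Gcd ((*) a ` range (\<lambda>i. u $ i))" by simp
  then have "b = a" using u w a b by (simp add: Gcd_mult)
  then have "q = 1" using b qab by simp
  then show ?thesis using q(2) by (simp add: to_rat_def vec_eq_iff)
qed

text \<open>
  This justifies the definite description in \<open>prim_vec\<close>: clearing denominators in \<open>v\<close> and dividing by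
  the greatest common divisor of the entries gives a primitive vector on the ray, and it is the only
  one.
\<close>

lemma prim_vec_generates:
  fixes v :: "rat ^ 'n"
  assumes v: "v \<noteq> 0"
  shows "cone_gen {v} = {q *s to_rat (prim_vec (cone_gen {v})) | q. 0 \<le> q}"
proof -
  obtain d w where d: "d > 0" "to_rat w = of_int d *s v" by (rule common_multiple_integral)
  define g where "g = Gcd (range (\<lambda>i. w $ i))"
  have "w \<noteq> 0"
  proof
    assume "w = 0"
    with d(2) have "of_int d *s v = 0" by (simp add: to_rat_def vec_eq_iff)
    with d(1) v show False by (simp add: vec_eq_iff)
  qed
  then have "g \<noteq> 0" unfolding g_def by (auto simp: vec_eq_iff)
  then have g: "g > 0" using Gcd_int_greater_eq_0[of "range (\<lambda>i. w $ i)"] unfolding g_def by linarith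
  have gdvd: "g dvd w $ i" for i unfolding g_def by (rule Gcd_dvd) simp
  define u :: "int ^ 'n" where "u = (\<chi> i. w $ i div g)"
  have gu: "g * u $ i = w $ i" for i using gdvd by (simp add: u_def)
  have "(*) g ` range (\<lambda>i. u $ i) = range (\<lambda>i. w $ i)" by (simp add: image_image gu)
  then have "g * Gcd (range (\<lambda>i. u $ i)) = g" using Gcd_mult[of g "range (\<lambda>i. u $ i)"] g
    by (simp add: g_def[symmetric] normalize_mult)
  then have prim: "Gcd (range (\<lambda>i. u $ i)) = 1" using g by simp
  have uv: "to_rat u = (of_int d / of_int g) *s v"
  proof -
    have "of_int (u $ i) = of_int d / of_int g * v $ i" for i
    proof -
      have "of_int (w $ i) = of_int d * v $ i" using d(2) by (simp add: to_rat_def vec_eq_iff)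
      then have "of_int g * (of_int (u $ i)) = of_int d * v $ i" by (simp flip: gu)
      then show ?thesis using g by (simp add: field_simps)
    qed
    then show ?thesis by (simp add: to_rat_def vec_eq_iff)
  qed
  have cone: "cone_gen {v} = {q *s to_rat u | q. 0 \<le> q}"
  proof (intro equalityI subsetI)
    fix x assume "x \<in> cone_gen {v}"
    then obtain q where "x = q *s v" "0 \<le> q" unfolding cone_gen_singleton by auto
    then show "x \<in> {q *s to_rat u | q. 0 \<le> q}" using d g
      by (intro CollectI exI[of _ "q * (of_int g / of_int d)"]) (simp add: uv vector_smult_assoc)
  next
    fix x assume "x \<in> {q *s to_rat u | q. 0 \<le> q}"
    then obtain q where "x = q *s to_rat u" "0 \<le> q" by auto
    then show "x \<in> cone_gen {v}" using d g unfolding cone_gen_singleton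
      by (intro CollectI exI[of _ "q * (of_int d / of_int g)"]) (simp add: uv vector_smult_assoc)
  qed
  have "prim_vec (cone_gen {v}) = u"
    unfolding prim_vec_def
  proof (rule the_equality)
    show "to_rat u \<in> cone_gen {v} \<and> Gcd (range (\<lambda>i. u $ i)) = 1"
      using prim by (auto simp: cone intro!: exI[of _ 1])
    fix w' assume "to_rat w' \<in> cone_gen {v} \<and> Gcd (range (\<lambda>i. w' $ i)) = 1"
    then show "w' = u" using primitive_multiple_unique[OF prim] unfolding cone by auto
  qed
  then show ?thesis using cone by simp
qed

lemma distinguished_ray_unique:
  assumes "distinguished_ray \<Sigma> e \<rho>" "distinguished_ray \<Sigma> e \<rho>'"
  shows "\<rho> = \<rho>'"
proof (rule ccontr)
  assume "\<rho> \<noteq> \<rho>'"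
  with assms have "0 \<le> pairing (prim_vec \<rho>') e" "pairing (prim_vec \<rho>') e = -1"
    unfolding distinguished_ray_def by auto
  then show False by simp
qed

lemma root_ray_distinguished:
  assumes "demazure_root \<Sigma> e"
  shows "distinguished_ray \<Sigma> e (root_ray \<Sigma> e)"
proof -
  obtain \<rho> where \<rho>: "distinguished_ray \<Sigma> e \<rho>" using assms unfolding demazure_root_def by blast
  then show ?thesis unfolding root_ray_def by (rule theI) (rule distinguished_ray_unique[OF _ \<rho>])
qed

lemma dual_lattice_cone_ray:
  assumes "\<rho> \<in> rays \<Sigma>"
  shows "dual_lattice_cone \<rho> = {m. 0 \<le> pairing (prim_vec \<rho>) m}"
proof -
  obtain v where v: "v \<noteq> 0" "\<rho> = cone_gen {v}" using assms unfolding rays_def by blast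
  have \<rho>: "\<rho> = {q *s to_rat (prim_vec \<rho>) | q. 0 \<le> q}" using prim_vec_generates[OF v(1)] v(2) by simp
  show ?thesis
  proof (intro equalityI subsetI)
    fix m assume "m \<in> dual_lattice_cone \<rho>"
    moreover have "1 *s to_rat (prim_vec \<rho>) \<in> \<rho>" by (subst \<rho>) (intro CollectI exI[of _ 1], simp)
    ultimately have "0 \<le> pairing (1 *s to_rat (prim_vec \<rho>)) m" unfolding dual_lattice_cone_def by blast
    then show "m \<in> {m. 0 \<le> pairing (prim_vec \<rho>) m}" unfolding pairing_scaled_to_rat by simp
  next
    fix m assume m: "m \<in> {m. 0 \<le> pairing (prim_vec \<rho>) m}"
    have "0 \<le> pairing w m" if "w \<in> \<rho>" for w
    proof -
      from that have "w \<in> {q *s to_rat (prim_vec \<rho>) | q. 0 \<le> q}" using \<rho> by simp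
      then show ?thesis using m by (auto simp: pairing_scaled_to_rat)
    qed
    then show "m \<in> dual_lattice_cone \<rho>" unfolding dual_lattice_cone_def by blast
  qed
qed

section \<open>The exponential of a root derivation on characters\<close>

lemma root_derivation_single:
  "root_derivation n e (Poly_Mapping.single m a) = Poly_Mapping.single (m + e) (a * of_int (pairing n m))"
  by (simp add: root_derivation_def)

lemma exp_derivation_finite:
  assumes "\<And>k. k > N \<Longrightarrow> (D ^^ k) p = 0"
  shows "exp_derivation D s p = (\<Sum>k\<le>N. Poly_Mapping.single 0 (s ^ k / fact k) * (D ^^ k) p)"
  unfolding exp_derivation_def
  by (rule sum.mono_neutral_left) (use assms linorder_not_less in \<open>auto simp: not_le[symmetric]\<close>)

text \<open>
  The derivation kills \<open>\<chi>\<^sup>m\<close>, so that only the term of order \<open>0\<close> survives.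
\<close>

lemma exp_root_derivation_invariant:
  assumes "pairing n m = 0"
  shows "exp_derivation (root_derivation n e) s (Poly_Mapping.single m 1) = Poly_Mapping.single m 1"
proof -
  have 0: "root_derivation n e 0 = 0" by (simp add: root_derivation_def)
  have "(root_derivation n e ^^ Suc k) (Poly_Mapping.single m 1) = 0" for k
    by (induction k) (simp_all add: root_derivation_single assms 0)
  then have "(root_derivation n e ^^ k) (Poly_Mapping.single m 1) = 0" if "k > 0" for k
    using that gr0_implies_Suc by metis
  then have "exp_derivation (root_derivation n e) s (Poly_Mapping.single m 1) =
      (\<Sum>k\<le>0. Poly_Mapping.single 0 (s ^ k / fact k) * (root_derivation n e ^^ k) (Poly_Mapping.single m 1))"
    by (rule exp_derivation_finite)
  then show ?thesis by simp
qed

text \<open>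
  The derivation maps \<open>\<chi>\<^sup>-\<^sup>e\<close> to \<open>\<langle>n, -e\<rangle> = 1\<close> and then to \<open>0\<close>: the additive group translates the
  coordinate \<open>\<chi>\<^sup>-\<^sup>e\<close>.
\<close>

lemma exp_root_derivation_translation:
  assumes "pairing n e = - 1"
  shows "exp_derivation (root_derivation n e) s (Poly_Mapping.single (- e) 1) =
    Poly_Mapping.single (- e) 1 + Poly_Mapping.single 0 s"
proof -
  let ?D = "root_derivation n e"
  have 0: "?D 0 = 0" by (simp add: root_derivation_def)
  have 1: "?D (Poly_Mapping.single (- e) 1) = Poly_Mapping.single 0 1"
    by (simp add: root_derivation_single pairing_uminus_right assms)
  have 2: "?D 1 = 0" using root_derivation_single[of n e 0 1] by (simp add: pairing_0_right)
  have "(?D ^^ (k + 2)) (Poly_Mapping.single (- e) 1) = 0" for k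
    by (induction k) (simp_all add: 0 1 2 numeral_2_eq_2)
  then have "(?D ^^ k) (Poly_Mapping.single (- e) 1) = 0" if "k > 1" for k
    using that by (metis Suc_1 Suc_leI add.commute le_Suc_ex)
  then have "exp_derivation ?D s (Poly_Mapping.single (- e) 1) =
      (\<Sum>k\<le>1. Poly_Mapping.single 0 (s ^ k / fact k) * (?D ^^ k) (Poly_Mapping.single (- e) 1))"
    by (rule exp_derivation_finite)
  then show ?thesis by (simp add: 1 mult_single)
qed

section \<open>Multiplicative functions on the character lattice\<close>

lemma multiplicative_scale:
  fixes \<phi> :: "int ^ 'n \<Rightarrow> 'k::field"
  assumes 0: "\<phi> 0 = 1" and add: "\<And>a b. \<phi> (a + b) = \<phi> a * \<phi> b"
  shows "\<phi> (k *s m) = \<phi> m powi k"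
proof -
  have nz: "\<phi> a \<noteq> 0" for a using add[of a "- a"] 0 by auto
  have succ: "\<phi> ((i + 1) *s m) = \<phi> (i *s m) * \<phi> m" for i
    using add[of "i *s m" m] by (simp add: vector_sadd_rdistrib)
  show ?thesis
  proof (induction k rule: int_induct[where k = 0])
    case base show ?case using 0 by simp
  next
    case (step1 i)
    then show ?case using succ[of i] nz by (simp add: power_int_add)
  next
    case (step2 i)
    then show ?case using succ[of "i - 1"] nz[of m] by (simp add: power_int_diff field_simps)
  qed
qed

text \<open>
  A homomorphism from the character lattice to the multiplicative group is evaluation at the point of
  the torus whose coordinates are its values on the standard basis. This is how a point of the chart
  gives rise to an element of the torus.
\<close>

lemma multiplicative_eq_character:
  fixes \<phi> :: "int ^ 'n \<Rightarrow> 'k::field"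
  assumes 0: "\<phi> 0 = 1" and add: "\<And>a b. \<phi> (a + b) = \<phi> a * \<phi> b"
  shows "\<phi> m = character m (\<chi> i. \<phi> (axis i 1))"
proof -
  have sum: "\<phi> (\<Sum>i\<in>S. m $ i *s axis i 1) = (\<Prod>i\<in>S. \<phi> (axis i 1) powi (m $ i))" if "finite S" for S
    using that by induction (simp_all add: 0 add multiplicative_scale[OF 0 add])
  have "(\<Sum>i\<in>UNIV. m $ i *s axis i 1) = m"
  proof (subst vec_eq_iff, intro allI)
    fix j
    have "(\<Sum>i\<in>UNIV. m $ i *s axis i 1) $ j = (\<Sum>i\<in>UNIV. if i = j then m $ j else 0)"
      unfolding sum_component by (intro sum.cong) (auto simp: axis_def)
    then show "(\<Sum>i\<in>UNIV. m $ i *s axis i 1) $ j = m $ j" by simp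
  qed
  with sum[of UNIV] show ?thesis by (simp add: character_def)
qed

section \<open>The chart of the distinguished ray\<close>

text \<open>
  The situation of the theorem, with the constant \<open>c\<close> by which the additive group is rescaled
  relative to the exponential of the root derivation made a parameter.
\<close>

locale toric_root =
  fixes X :: "('p, 'k::field_char_0) fspace"
    and act :: "'k ^ 'n \<Rightarrow> 'p \<Rightarrow> 'p"
    and \<Sigma> :: "(rat ^ 'n) set set"
    and x0 :: 'p
    and U :: "(rat ^ 'n) set \<Rightarrow> 'p set"
    and \<alpha> :: "'k \<Rightarrow> 'p \<Rightarrow> 'p"
    and e :: "int ^ 'n"
    and c :: 'k
  assumes toric: "toric_variety X act"
    and has_fan: "has_fan X act \<Sigma> x0 U"
    and add_action: "regular_action add_group add_group_space X \<alpha>"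
    and normalized: "normalized_by_torus X act \<alpha>"
    and root: "demazure_root \<Sigma> e"
    and c: "c \<noteq> 0"
    and \<alpha>_chart: "\<And>\<sigma> s x. \<sigma> \<in> \<Sigma> \<Longrightarrow> root_ray \<Sigma> e \<subseteq> \<sigma> \<Longrightarrow> x \<in> U \<sigma> \<Longrightarrow> \<alpha> s x \<in> U \<sigma>"
    and \<alpha>_represents: "\<And>\<sigma> s f p. \<sigma> \<in> \<Sigma> \<Longrightarrow> root_ray \<Sigma> e \<subseteq> \<sigma> \<Longrightarrow> represents X act x0 \<sigma> (U \<sigma>) f p \<Longrightarrow>
      represents X act x0 \<sigma> (U \<sigma>) (\<lambda>x. f (\<alpha> s x))
        (exp_derivation (root_derivation (prim_vec (root_ray \<Sigma> e)) e) (c * s) p)"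
begin

abbreviation "\<rho> \<equiv> root_ray \<Sigma> e"
abbreviation "n \<equiv> prim_vec \<rho>"
abbreviation "V \<equiv> U \<rho>"

lemma normal: "normal_variety X"
  using toric by (simp add: toric_variety_def)

lemma swf: "space_with_functions X"
  using normal by (simp add: normal_variety_def variety_def)

lemma irreducible: "openin (topol X) W \<Longrightarrow> openin (topol X) W' \<Longrightarrow> W \<noteq> {} \<Longrightarrow> W' \<noteq> {} \<Longrightarrow> W \<inter> W' \<noteq> {}"
  using normal unfolding normal_variety_def variety_def by simp

lemma torus_action: "group_action torus (points X) act"
  and torus_morphism: "morphism (prod_space torus_space X) X (\<lambda>(t, x). act t x)"
  using toric by (simp_all add: toric_variety_def regular_action_def)

lemma \<alpha>_action: "group_action add_group (points X) \<alpha>"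
  and \<alpha>_morphism: "morphism (prod_space add_group_space X) X (\<lambda>(s, x). \<alpha> s x)"
  using add_action by (simp_all add: regular_action_def)

sublocale T: group_action torus "points X" act by (rule torus_action)
sublocale A: group_action add_group "points X" \<alpha> by (rule \<alpha>_action)

lemma x0: "x0 \<in> points X" and orbit_open: "openin (topol X) (orbit torus act x0)"
  using has_fan by (simp_all add: has_fan_def)

lemma \<rho>_ray: "\<rho> \<in> rays \<Sigma>" and pairing_n_e: "pairing n e = - 1"
  using root_ray_distinguished[OF root] by (simp_all add: distinguished_ray_def)

lemma \<rho>_in: "\<rho> \<in> \<Sigma>"
  using \<rho>_ray by (simp add: rays_def)

lemma chart: "toric_chart X act x0 \<rho> V"
  using has_fan \<rho>_in by (simp add: has_fan_def)

lemma V_open: "openin (topol X) V" and x0_V: "x0 \<in> V" and V_affine: "affine_space (induced X V)"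
  and act_V: "t \<in> carrier torus \<Longrightarrow> x \<in> V \<Longrightarrow> act t x \<in> V"
  and V_represented: "f \<in> reg X V \<Longrightarrow> \<exists>p. represents X act x0 \<rho> V f p"
  and V_representable: "Poly_Mapping.keys p \<subseteq> dual_lattice_cone \<rho> \<Longrightarrow> \<exists>f. represents X act x0 \<rho> V f p"
  using chart by (simp_all add: toric_chart_def)

lemma V_points: "x \<in> V \<Longrightarrow> x \<in> points X"
  using openin_subset_points[OF V_open] by blast

lemma \<alpha>_V: "x \<in> V \<Longrightarrow> \<alpha> s x \<in> V"
  by (rule \<alpha>_chart[OF \<rho>_in order_refl])

lemma dual_\<rho>: "dual_lattice_cone \<rho> = {m. 0 \<le> pairing n m}"
  by (rule dual_lattice_cone_ray[OF \<rho>_ray])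

lemma one_torus: "\<one>\<^bsub>torus\<^esub> \<in> carrier (torus :: ('k ^ 'n) monoid)"
  by (simp add: torus_def)

lemma act_one: "x \<in> points X \<Longrightarrow> act \<one>\<^bsub>torus\<^esub> x = x"
  using T.id_eq_one by (metis restrict_apply)

lemma character_one: "character m (\<one>\<^bsub>torus\<^esub> :: 'k ^ 'n) = 1"
  by (simp add: character_def torus_def)

lemma \<alpha>_points: "x \<in> points X \<Longrightarrow> \<alpha> s x \<in> points X"
  using A.element_image[of s x] by (simp add: add_group_def)

lemma act_points: "t \<in> carrier torus \<Longrightarrow> x \<in> points X \<Longrightarrow> act t x \<in> points X"
  using T.element_image[of t x] by simp

lemma \<alpha>_add: "x \<in> points X \<Longrightarrow> \<alpha> (s + s') x = \<alpha> s (\<alpha> s' x)"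
  using A.composition_rule[of x s s'] by (simp add: add_group_def)

lemma \<alpha>_0: "x \<in> points X \<Longrightarrow> \<alpha> 0 x = x"
  using A.id_eq_one by (simp add: add_group_def) (metis restrict_apply)

lemma act_mult: "x \<in> points X \<Longrightarrow> t \<in> carrier torus \<Longrightarrow> u \<in> carrier torus \<Longrightarrow>
    act (t \<otimes>\<^bsub>torus\<^esub> u) x = act t (act u x)"
  by (rule T.composition_rule)

lemma act_morphism:
  assumes t: "t \<in> carrier torus"
  shows "morphism X X (act t)"
proof -
  have "morphism X (prod_space torus_space X) (\<lambda>x. (t, x))"
    by (intro morphism_into_prod space_with_functions_torus swf morphism_const morphism_id)
      (simp add: points_torus_space t)
  from morphism_compose[OF this torus_morphism] show ?thesis by simp
qed

text \<open>
  The locus where \<open>f\<close> and \<open>g\<close> differ is open and misses the open orbit of the torus, so that it is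
  empty by irreducibility.
\<close>

lemma agree_on_chart:
  assumes f: "f \<in> reg X V" and g: "g \<in> reg X V"
    and eq: "\<And>t. t \<in> carrier torus \<Longrightarrow> f (act t x0) = g (act t x0)" and x: "x \<in> V"
  shows "f x = g x"
proof (rule ccontr)
  assume "f x \<noteq> g x"
  then have "{x\<in>V. f x \<noteq> g x} \<noteq> {}" using x by blast
  moreover have "orbit torus act x0 \<noteq> {}" using one_torus by (auto simp: orbit_def)
  ultimately have "{x\<in>V. f x \<noteq> g x} \<inter> orbit torus act x0 \<noteq> {}"
    by (intro irreducible orbit_open openin_disagreement[OF swf f V_open g])
  then show False using eq by (auto simp: orbit_def)
qed

text \<open>
  The character \<open>\<chi>\<^sup>m\<close> as a regular function on the chart. A choice is made because regular functions
  are total functions of which only the restriction to the chart is determined.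
\<close>

definition coord :: "int ^ 'n \<Rightarrow> 'p \<Rightarrow> 'k" where
  "coord m = (SOME f. represents X act x0 \<rho> V f (Poly_Mapping.single m 1))"

lemma coord_represents:
  assumes "0 \<le> pairing n m"
  shows "represents X act x0 \<rho> V (coord m) (Poly_Mapping.single m 1)"
  unfolding coord_def
  by (rule someI_ex[OF V_representable]) (use assms in \<open>auto simp: dual_\<rho>\<close>)

lemma coord_reg: "0 \<le> pairing n m \<Longrightarrow> coord m \<in> reg X V"
  using coord_represents by (simp add: represents_def)

lemma coord_act: "0 \<le> pairing n m \<Longrightarrow> t \<in> carrier torus \<Longrightarrow> coord m (act t x0) = character m t"
  using coord_represents by (simp add: represents_def laurent_eval_single)

lemma coord_add:
  assumes m: "0 \<le> pairing n m" "0 \<le> pairing n m'" and x: "x \<in> V"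
  shows "coord (m + m') x = coord m x * coord m' x"
proof -
  have mm: "0 \<le> pairing n (m + m')" using m by (simp add: pairing_add_right)
  show ?thesis
    by (rule agree_on_chart[OF coord_reg[OF mm] reg_mult[OF swf V_open coord_reg[OF m(1)] coord_reg[OF m(2)]] _ x])
      (simp add: coord_act m mm character_add)
qed

lemma coord_0:
  assumes x: "x \<in> V"
  shows "coord 0 x = 1"
  by (rule agree_on_chart[OF coord_reg reg_const[OF swf V_open] _ x])
    (simp_all add: coord_act pairing_0_right)

lemma pairing_n_minus_e: "pairing n (- e) = 1"
  by (simp add: pairing_uminus_right pairing_n_e)

text \<open>
  The coordinate ring of the chart is spanned by characters. By density it is enough to compare a
  regular function with the combination given by its Laurent polynomial on the open orbit.
\<close>

lemma regular_is_combination: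
  assumes f: "f \<in> reg X V"
  obtains p where "Poly_Mapping.keys p \<subseteq> dual_lattice_cone \<rho>"
    "\<forall>x\<in>V. f x = (\<Sum>m\<in>Poly_Mapping.keys p. Poly_Mapping.lookup p m * coord m x)"
proof -
  obtain p where p: "represents X act x0 \<rho> V f p" using V_represented[OF f] by blast
  then have keys: "Poly_Mapping.keys p \<subseteq> dual_lattice_cone \<rho>" by (simp add: represents_def)
  have reg: "(\<lambda>x. \<Sum>m\<in>S. Poly_Mapping.lookup p m * coord m x) \<in> reg X V"
    if "finite S" "S \<subseteq> Poly_Mapping.keys p" for S
    using that
  proof induction
    case empty show ?case using reg_const[OF swf V_open, of 0] by simp
  next
    case (insert m S)
    then have "0 \<le> pairing n m" using keys dual_\<rho> by auto
    then have "(\<lambda>x. Poly_Mapping.lookup p m * coord m x + (\<Sum>m\<in>S. Poly_Mapping.lookup p m * coord m x)) \<in> reg X V"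
      using insert by (intro reg_add[OF swf V_open] reg_mult[OF swf V_open] reg_const[OF swf V_open] coord_reg) auto
    with insert show ?case by simp
  qed
  have "f x = (\<Sum>m\<in>Poly_Mapping.keys p. Poly_Mapping.lookup p m * coord m x)" if "x \<in> V" for x
  proof (rule agree_on_chart[OF f reg _ that])
    fix t :: "'k ^ 'n" assume t: "t \<in> carrier torus"
    have "f (act t x0) = laurent_eval p t" using p t by (simp add: represents_def)
    also have "\<dots> = (\<Sum>m\<in>Poly_Mapping.keys p. Poly_Mapping.lookup p m * coord m (act t x0))"
      unfolding laurent_eval_def using keys by (intro sum.cong) (auto simp: dual_\<rho> coord_act t)
    finally show "f (act t x0) = (\<Sum>m\<in>Poly_Mapping.keys p. Poly_Mapping.lookup p m * coord m (act t x0))" .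
  qed simp_all
  then show thesis by (intro that[OF keys]) blast
qed

text \<open>
  This is the splitting \<open>\<nat>(-e) + n\<^sup>\<bottom>\<close> of the semigroup of the chart at the level of functions.
\<close>

lemma coord_decomposition:
  assumes x: "x \<in> V" and m: "pairing n m = 0"
  shows "coord (m - int k *s e) x = coord (- e) x ^ k * coord m x"
proof (induction k)
  case (Suc k)
  have eq: "m - int (Suc k) *s e = - e + (m - int k *s e)"
    by (simp add: vec_eq_iff algebra_simps)
  have "pairing n (m - int k *s e) = int k"
    using pairing_add_right[of n m "- (int k *s e)"]
    by (simp add: m pairing_uminus_right pairing_scale_right pairing_n_e)
  then have "coord (- e + (m - int k *s e)) x = coord (- e) x * coord (m - int k *s e) x"
    by (intro coord_add x) (simp_all add: pairing_n_minus_e)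
  with Suc show ?case unfolding eq by simp
qed simp

text \<open>
  Every \<open>m\<close> with \<open>\<langle>n, m\<rangle> \<ge> 0\<close> is \<open>\<langle>n, m\<rangle> (-e)\<close> plus an element of \<open>n\<^sup>\<bottom>\<close>, so that the given
  coordinates determine all regular functions at a point, and these separate points.
\<close>

lemma chart_point_eqI:
  assumes x: "x \<in> V" and y: "y \<in> V" and e: "coord (- e) x = coord (- e) y"
    and perp: "\<And>m. pairing n m = 0 \<Longrightarrow> coord m x = coord m y"
  shows "x = y"
proof (rule affine_space_separates[OF swf V_open V_affine x y])
  have coord: "coord m x = coord m y" if "0 \<le> pairing n m" for m
  proof -
    let ?k = "nat (pairing n m)" and ?m = "m + pairing n m *s e"
    have "pairing n ?m = 0" by (simp add: pairing_add_right pairing_scale_right pairing_n_e)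
    then have "coord (?m - int ?k *s e) x = coord (?m - int ?k *s e) y"
      by (simp only: coord_decomposition[OF x] coord_decomposition[OF y] e perp)
    moreover have "?m - int ?k *s e = m" using that by simp
    ultimately show ?thesis by simp
  qed
  fix f assume "f \<in> reg X V"
  then obtain p where p: "Poly_Mapping.keys p \<subseteq> dual_lattice_cone \<rho>"
    "\<forall>x\<in>V. f x = (\<Sum>m\<in>Poly_Mapping.keys p. Poly_Mapping.lookup p m * coord m x)"
    by (rule regular_is_combination)
  have "(\<Sum>m\<in>Poly_Mapping.keys p. Poly_Mapping.lookup p m * coord m x) =
      (\<Sum>m\<in>Poly_Mapping.keys p. Poly_Mapping.lookup p m * coord m y)"
    using p(1) by (intro sum.cong) (auto simp: dual_\<rho> coord)
  then show "f x = f y" using p(2) x y by simp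
qed

lemma coord_\<alpha>_perp:
  assumes m: "pairing n m = 0" and t: "t \<in> carrier torus"
  shows "coord m (\<alpha> s (act t x0)) = character m t"
  using \<alpha>_represents[OF \<rho>_in order_refl coord_represents, of m s] t m
  by (simp add: represents_def exp_root_derivation_invariant laurent_eval_single)

lemma coord_\<alpha>_e:
  assumes t: "t \<in> carrier torus"
  shows "coord (- e) (\<alpha> s (act t x0)) = character (- e) t + c * s"
  using \<alpha>_represents[OF \<rho>_in order_refl coord_represents, of "- e" s] t
  by (simp add: represents_def exp_root_derivation_translation pairing_n_e pairing_n_minus_e
      laurent_eval_single laurent_eval_add)

text \<open>
  On the open orbit \<open>t\<close> multiplies \<open>\<chi>\<^sup>-\<^sup>e\<close> by \<open>e(t)\<^sup>-\<^sup>1 = 1\<close>, and the orbit is dense.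
\<close>

lemma coord_e_ker:
  assumes t: "t \<in> carrier torus" "character e t = 1" and x: "x \<in> V"
  shows "coord (- e) (act t x) = coord (- e) x"
proof -
  have eq: "{x\<in>points X. act t x \<in> V} \<supseteq> V" using act_V[OF t(1)] V_points by blast
  have "(\<lambda>x. coord (- e) (act t x)) \<in> reg X {x\<in>points X. act t x \<in> V}"
    by (rule reg_pullback[OF act_morphism[OF t(1)] V_open coord_reg]) (simp add: pairing_n_minus_e)
  then have reg: "(\<lambda>x. coord (- e) (act t x)) \<in> reg X V"
    by (rule reg_subset[OF swf openin_preimage_morphism[OF act_morphism[OF t(1)] V_open] V_open eq])
  have "coord (- e) (act t (act u x0)) = coord (- e) (act u x0)" if u: "u \<in> carrier torus" for u
  proof -
    have tu: "t \<otimes>\<^bsub>torus\<^esub> u \<in> carrier torus" using t u by (simp add: carrier_torus) (simp add: torus_def)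
    have "coord (- e) (act t (act u x0)) = character (- e) (t \<otimes>\<^bsub>torus\<^esub> u)"
      using coord_act[OF _ tu, of "- e"] by (simp add: act_mult[OF x0 t(1) u] pairing_n_minus_e)
    also have "\<dots> = coord (- e) (act u x0)"
      by (simp add: character_mult character_uminus t u coord_act pairing_n_minus_e)
    finally show ?thesis .
  qed
  then show ?thesis
    by (intro agree_on_chart[OF reg coord_reg _ x]) (simp_all add: pairing_n_minus_e)
qed

text \<open>
  As the action is normalized, moving \<open>t\<close> past the additive group replaces \<open>s\<close> by some \<open>s'\<close> that does
  not depend on the point. Since \<open>t\<close> preserves \<open>\<chi>\<^sup>-\<^sup>e\<close> on the chart, and the additive group translates
  it there by \<open>cs\<close> and \<open>cs'\<close> respectively, evaluation at \<open>x0\<close> gives \<open>s = s'\<close>.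
\<close>

lemma commute:
  assumes t: "t \<in> carrier torus" "character e t = 1" and x: "x \<in> points X"
  shows "act t (\<alpha> s x) = \<alpha> s (act t x)"
proof -
  obtain s' where s': "\<And>x. x \<in> points X \<Longrightarrow> act t (\<alpha> s x) = \<alpha> s' (act t x)"
    using normalized t(1) unfolding normalized_by_torus_def by meson
  have "coord (- e) (act t (\<alpha> s x0)) = coord (- e) (\<alpha> s (act \<one>\<^bsub>torus\<^esub> x0))"
    using coord_e_ker[OF t \<alpha>_V[OF x0_V]] by (simp add: act_one x0)
  also have "\<dots> = 1 + c * s" by (simp add: coord_\<alpha>_e one_torus character_one)
  finally have "1 + c * s = coord (- e) (\<alpha> s' (act t x0))" by (simp add: s' x0)
  also have "\<dots> = 1 + c * s'" by (simp add: coord_\<alpha>_e t character_uminus)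
  finally have "s = s'" using c by simp
  with s'[OF x] show ?thesis by simp
qed

text \<open>
  The torus element is the one whose value on characters \<open>m \<in> n\<^sup>\<bottom>\<close> is \<open>\<chi>\<^sup>m(y)\<close> and whose value on
  \<open>e\<close> is \<open>1\<close>; it is obtained from the projection \<open>m \<mapsto> m + \<langle>n, m\<rangle>e\<close> of the character lattice onto
  \<open>n\<^sup>\<bottom>\<close> along \<open>e\<close>. The translation then adjusts the remaining coordinate \<open>\<chi>\<^sup>-\<^sup>e\<close>, whose value at
  \<open>x0\<close> is \<open>1\<close>.
\<close>

lemma reach_chart:
  assumes y: "y \<in> V"
  obtains t s where "t \<in> carrier torus" "character e t = 1" "act t (\<alpha> s x0) = y"
proof -
  let ?\<phi> = "\<lambda>m. coord (m + pairing n m *s e) y"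
  have perp: "pairing n (m + pairing n m *s e) = 0" for m
    by (simp add: pairing_add_right pairing_scale_right pairing_n_e)
  have 0: "?\<phi> 0 = 1" by (simp add: pairing_0_right coord_0 y)
  have add: "?\<phi> (a + b) = ?\<phi> a * ?\<phi> b" for a b
  proof -
    have eq: "a + b + pairing n (a + b) *s e = (a + pairing n a *s e) + (b + pairing n b *s e)"
      by (simp add: pairing_add_right vec_eq_iff algebra_simps)
    show ?thesis unfolding eq by (rule coord_add[OF _ _ y]) (simp_all only: perp order_refl)
  qed
  define t where "t = (\<chi> i. ?\<phi> (axis i 1))"
  have \<phi>: "?\<phi> m = character m t" for m
    unfolding t_def using 0 add by (rule multiplicative_eq_character)
  have "?\<phi> m \<noteq> 0" for m using add[of m "- m"] 0 by auto
  then have t: "t \<in> carrier torus" by (simp add: carrier_torus t_def)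
  have "e + pairing n e *s e = 0" by (simp add: pairing_n_e vec_eq_iff)
  then have te: "character e t = 1" using \<phi>[of e] by (simp add: coord_0 y)
  define s where "s = (coord (- e) y - 1) / c"
  have "\<alpha> s (act t x0) = y"
  proof (rule chart_point_eqI[OF \<alpha>_V[OF act_V[OF t x0_V]] y])
    show "coord (- e) (\<alpha> s (act t x0)) = coord (- e) y"
      using c by (simp add: coord_\<alpha>_e t te character_uminus s_def)
    show "coord m (\<alpha> s (act t x0)) = coord m y" if "pairing n m = 0" for m
      using \<phi>[of m] that by (simp add: coord_\<alpha>_perp t)
  qed
  then show thesis using that[OF t te, of s] commute[OF t te x0] by simp
qed

text \<open>
  The coordinate \<open>\<chi>\<^sup>-\<^sup>e\<close> shows that \<open>s = 0\<close>, and the coordinates in \<open>n\<^sup>\<bottom>\<close> show that \<open>t\<close> is in the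
  kernel of all characters in \<open>n\<^sup>\<bottom>\<close>. Together with \<open>e\<close> these generate the character lattice.
\<close>

lemma trivial_stabilizer:
  assumes t: "t \<in> carrier torus" "character e t = 1" and fix_x0: "act t (\<alpha> s x0) = x0"
  shows "s = 0" "t = \<one>\<^bsub>torus\<^esub>"
proof -
  have x: "\<alpha> s (act t x0) = x0" using fix_x0 commute[OF t x0] by simp
  have one: "coord m x0 = 1" if "0 \<le> pairing n m" for m
    using coord_act[OF that one_torus] by (simp add: act_one x0 character_one)
  have "1 + c * s = 1"
    using coord_\<alpha>_e[OF t(1), of s] by (simp add: x one pairing_n_minus_e character_uminus t)
  then show "s = 0" using c by simp
  have "t $ i = 1" for i
  proof -
    let ?d = "axis i 1 + (n $ i) *s e"
    have "pairing n ?d = 0" by (simp add: pairing_add_right pairing_scale_right pairing_n_e pairing_axis)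
    then have "character ?d t = 1" using coord_\<alpha>_perp[OF _ t(1), of ?d s] by (simp add: x one)
    moreover have "character ((n $ i) *s e) t = 1"
      by (subst multiplicative_scale) (simp_all add: character_add t)
    ultimately show ?thesis by (simp add: character_add t character_axis)
  qed
  then show "t = \<one>\<^bsub>torus\<^esub>" by (simp add: torus_def vec_eq_iff)
qed

section \<open>The embedding\<close>

abbreviation "G \<equiv> (ker_group e :: ('k ^ 'n) monoid) \<times>\<times> (add_group :: 'k monoid)"
abbreviation "G_space \<equiv> prod_space (ker_space e) (add_group_space :: ('k, 'k) fspace)"
abbreviation "G_act \<equiv> (\<lambda>(t, s). restrict (\<lambda>y. act t (\<alpha> s y)) (points X))"

lemma carrier_G: "carrier G = {t \<in> carrier torus. character e t = 1} \<times> UNIV"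
  by (simp add: carrier_ker_group) (simp add: add_group_def)

text \<open>
  The product of two commuting actions is an action.
\<close>

lemma G_group_action: "group_action G (points X) G_act"
proof -
  have torus: "group (torus :: ('k ^ 'n) monoid)" using T.group_hom by (rule group_hom.axioms)
  have add: "group (add_group :: 'k monoid)" using A.group_hom by (rule group_hom.axioms)
  have G: "group G" by (rule DirProd_group[OF group_ker_group[OF torus] add])
  have bij: "G_act g \<in> Bij (points X)" if "g \<in> carrier G" for g
  proof -
    obtain t s where g: "g = (t, s)" by (cases g)
    have "act t \<in> Bij (points X)" using that g by (intro T.bij_prop0) (simp add: carrier_ker_group)
    moreover have "\<alpha> s \<in> Bij (points X)" by (intro A.bij_prop0) (simp add: add_group_def)
    ultimately have "compose (points X) (act t) (\<alpha> s) \<in> Bij (points X)" by (rule compose_Bij)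
    then show ?thesis by (simp add: g compose_def)
  qed
  have mult: "G_act (g \<otimes>\<^bsub>G\<^esub> h) = compose (points X) (G_act g) (G_act h)"
    if g: "g \<in> carrier G" and h: "h \<in> carrier G" for g h
  proof -
    obtain t s t' s' where gh: "g = (t, s)" "h = (t', s')" by (cases g; cases h)
    with g h have t: "t \<in> carrier torus" "character e t = 1" "t' \<in> carrier torus" "character e t' = 1"
      unfolding carrier_G by auto
    have "act (t \<otimes>\<^bsub>torus\<^esub> t') (\<alpha> (s + s') x) = act t (\<alpha> s (act t' (\<alpha> s' x)))" if x: "x \<in> points X" for x
      using x t by (simp add: \<alpha>_add \<alpha>_points act_mult commute)
    moreover have "g \<otimes>\<^bsub>G\<^esub> h = (t \<otimes>\<^bsub>torus\<^esub> t', s + s')"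
      by (simp add: gh ker_group_def add_group_def)
    ultimately show ?thesis
      using t by (auto simp: gh compose_def fun_eq_iff act_points \<alpha>_points)
  qed
  have "G_act \<in> hom G (BijGroup (points X))"
    by (rule homI) (use bij mult in \<open>auto simp: BijGroup_def\<close>)
  then show ?thesis
    by (intro group_action.intro group_hom.intro group_hom_axioms.intro G group_BijGroup)
qed

lemma G_morphism: "morphism (prod_space G_space X) X (\<lambda>(g, x). G_act g x)"
proof -
  note K = space_with_functions_ker and A = space_with_functions_add_group
  note S = space_with_functions_prod[OF K A]
  note Z = space_with_functions_prod[OF S swf]
  note g = morphism_fst[OF S swf] and x = morphism_snd[OF S swf]
  have t: "morphism (prod_space G_space X) torus_space (\<lambda>z. fst (fst z))"
    by (rule morphism_compose[OF morphism_compose[OF g morphism_fst[OF K A]] morphism_ker_torus])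
  have s: "morphism (prod_space G_space X) add_group_space (\<lambda>z. snd (fst z))"
    by (rule morphism_compose[OF g morphism_snd[OF K A]])
  have "morphism (prod_space G_space X) X (\<lambda>z. \<alpha> (snd (fst z)) (snd z))"
    using morphism_compose[OF morphism_into_prod[OF A swf Z s x] \<alpha>_morphism] by simp
  from morphism_compose[OF morphism_into_prod[OF space_with_functions_torus swf Z t this] torus_morphism]
  have "morphism (prod_space G_space X) X (\<lambda>z. act (fst (fst z)) (\<alpha> (snd (fst z)) (snd z)))" by simp
  then show ?thesis
    by (rule morphism_cong[OF Z]) (auto simp: points_prod_space[OF S swf])
qed

text \<open>
  The orbit of \<open>x0\<close> is the chart, which gives openness and, by irreducibility, density.
\<close>

lemma embedding: "equivariant_embedding G G_space X G_act x0"
proof -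
  have action: "regular_action G G_space X G_act"
    unfolding regular_action_def
    by (simp add: G_group_action G_morphism points_prod_space space_with_functions_ker
        space_with_functions_add_group points_ker_space points_add_group_space)
      (simp add: add_group_def)
  have orbit: "orbit G G_act x0 = V"
  proof (intro equalityI subsetI)
    fix y assume "y \<in> orbit G G_act x0"
    then show "y \<in> V" unfolding orbit_def carrier_G by (auto simp: x0 act_V \<alpha>_V x0_V)
  next
    fix y assume "y \<in> V"
    then obtain t s where "t \<in> carrier torus" "character e t = 1" "act t (\<alpha> s x0) = y" by (rule reach_chart)
    then show "y \<in> orbit G G_act x0"
      unfolding orbit_def carrier_G by (intro CollectI exI[of _ "(t, s)"]) (simp add: x0)
  qed
  have "stabilizer G G_act x0 = {\<one>\<^bsub>G\<^esub>}"
  proof (intro equalityI subsetI)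
    fix g assume "g \<in> stabilizer G G_act x0"
    then obtain t s where "g = (t, s)" "t \<in> carrier torus" "character e t = 1" "act t (\<alpha> s x0) = x0"
      unfolding stabilizer_def carrier_G by (auto simp: x0)
    with trivial_stabilizer[of t s] show "g \<in> {\<one>\<^bsub>G\<^esub>}" by (simp add: ker_group_def add_group_def)
  next
    fix g assume "g \<in> {\<one>\<^bsub>G\<^esub>}"
    then have g: "g = (\<one>\<^bsub>torus\<^esub>, 0)" by (simp add: ker_group_def add_group_def)
    show "g \<in> stabilizer G G_act x0"
      unfolding stabilizer_def carrier_G g using one_torus by (simp add: x0 \<alpha>_0 act_one character_one)
  qed
  moreover have "topol X closure_of V = points X"
  proof (intro equalityI subsetI)
    show "x \<in> points X" if "x \<in> topol X closure_of V" for x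
      using that by (simp add: in_closure_of points_def)
    fix x assume x: "x \<in> points X"
    have "\<exists>y\<in>V. y \<in> W" if "x \<in> W" "openin (topol X) W" for W
      using irreducible[OF that(2) V_open] that(1) x0_V by blast
    with x show "x \<in> topol X closure_of V" by (auto simp: in_closure_of points_def)
  qed
  ultimately show ?thesis
    unfolding equivariant_embedding_def orbit using normal action x0 V_open by simp
qed

end

theorem proposition6:
  fixes X :: "('p, 'k::{alg_closed_field, field_char_0}) fspace"
    and act :: "'k ^ 'n \<Rightarrow> 'p \<Rightarrow> 'p"
    and \<Sigma> :: "(rat ^ 'n) set set"
    and x0 :: 'p
    and U :: "(rat ^ 'n) set \<Rightarrow> 'p set"
    and \<alpha> :: "'k \<Rightarrow> 'p \<Rightarrow> 'p"
    and e :: "int ^ 'n"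
  assumes "toric_variety X act"
    and "has_fan X act \<Sigma> x0 U"
    and "regular_action add_group add_group_space X \<alpha>"
    and "\<exists>s. \<exists>x\<in>points X. \<alpha> s x \<noteq> x"
    and "normalized_by_torus X act \<alpha>"
    and "demazure_root \<Sigma> e"
    and "represented_by_root X act \<Sigma> x0 U \<alpha> e"
  shows "\<exists>x. equivariant_embedding
               (ker_group e \<times>\<times> add_group)
               (prod_space (ker_space e) add_group_space)
               X
               (\<lambda>(t, s). restrict (\<lambda>y. act t (\<alpha> s y)) (points X))
               x"
proof -
  from assms(7) obtain c where c: "c \<noteq> 0"
    and charts: "\<forall>\<sigma>\<in>\<Sigma>. root_ray \<Sigma> e \<subseteq> \<sigma> \<longrightarrow>
           (\<forall>s. \<forall>x\<in>U \<sigma>. \<alpha> s x \<in> U \<sigma>) \<and>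
           (\<forall>s f p. represents X act x0 \<sigma> (U \<sigma>) f p \<longrightarrow>
              represents X act x0 \<sigma> (U \<sigma>) (\<lambda>x. f (\<alpha> s x))
                (exp_derivation (root_derivation (prim_vec (root_ray \<Sigma> e)) e) (c * s) p))"
    unfolding represented_by_root_def by (elim conjE exE)
  interpret toric_root X act \<Sigma> x0 U \<alpha> e c
    using assms(1-3,5,6) c charts by unfold_locales simp_all
  show ?thesis using embedding by (rule exI)
qed

end
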